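(* Let $\kappa\in[-\frac14,\infty)$, $\alpha\in(0,1)$, let $\Omega\subset\mathbb{R}^n$ be such that $\Omega\cap B_1$ is a $C^{1,\alpha}$ domain (i.e. $\Omega$ is of class $C^{1,\alpha}$ in $B_1$), and let $d$ be the regularized distance to $\partial\Omega$. Let $\theta_-=\frac{1-\sqrt{1+4\kappa}}{2}$. Let $v\in C(\Omega\cap B_1)$ be any viscosity solution of $$-\Delta v+\kappa\,\frac{v}{d^2}\le 0\quad\text{in}\quad\Omega\cap B_1$$ satisfying $$\lim_{x\to\partial\Omega}\frac{v}{d^{\theta_-}}\le 0\ \text{ if }\ \kappa>-\tfrac14,\qquad \lim_{x\to\partial\Omega}\frac{v}{d^{1/2}|\log d|}\le 0\ \text{ if }\ \kappa=-\tfrac14 .$$ Then there exists $\rho\in(0,1)$, depending only on the $C^{1,\alpha}$ norm of $\partial\Omega$, such that for any $r\in(0,\rho]$, if $v\le 0$ on $\Omega\cap\partial B_r$, then $v\le 0$ in $\Omega\cap B_r$.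
   Context: $B_r$ is the ball of radius $r$ centered at the origin in $\mathbb{R}^n$. Standing conventions on domains: $0\in\partial\Omega$, the outer unit normal to $\Omega$ at $0$ is $-e_n$, and $\partial\Omega\cap B_2$ is a graph with $C^{1,\alpha}$ norm bounded by one. Regularized distance: fix a radial nonnegative $\phi\in C_c^\infty(B_1)$ with $\int\phi=1$, let $\mathrm{dist}(x)=\mathrm{dist}(x,\partial\Omega)$, and $G(x,\rho)=\int_{B_1}\mathrm{dist}\big(x-\tfrac{\rho}{2}z\big)\phi(z)\,dz$. The regularized distance $d$ is defined on $\Omega\cap B_1$ implicitly by $d(x)=G(x,d(x))$. When $\Omega$ is $C^\beta$, $\beta>1$, $\beta\notin\mathbb N$ (here $\beta=1+\alpha$), it satisfies $d\in C^\infty(\Omega\cap B_1)\cap C^\beta(\overline\Omega\cap B_1)$, $C^{-1}\mathrm{dist}\le d\le C\,\mathrm{dist}$, $|\nabla d|=1$ on $\partial\Omega$, and $|\partial^\mu d|\le C_{|\mu|}\,d^{\beta-|\mu|}$ for multi-indices with $|\mu|>\beta$. *)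

theory Defs
  imports "HOL-Analysis.Analysis"
begin

abbreviation partial_deriv :: "'a::euclidean_space \<Rightarrow> ('a \<Rightarrow> real) \<Rightarrow> 'a \<Rightarrow> real"
  where "partial_deriv b f x \<equiv> frechet_derivative f (at x) b"

text \<open>Intended for open \<open>S\<close>.\<close>

primrec Ck_on :: "nat \<Rightarrow> ('a::euclidean_space \<Rightarrow> real) \<Rightarrow> 'a set \<Rightarrow> bool" where
  "Ck_on 0 f S \<longleftrightarrow> continuous_on S f"
| "Ck_on (Suc k) f S \<longleftrightarrow>
     (\<forall>x\<in>S. f differentiable (at x)) \<and> (\<forall>b\<in>Basis. Ck_on k (partial_deriv b f) S)"

definition laplacian :: "('a::euclidean_space \<Rightarrow> real) \<Rightarrow> 'a \<Rightarrow> real"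
  where "laplacian f x = (\<Sum>b\<in>Basis. partial_deriv b (partial_deriv b f) x)"

text \<open>The norm \<open>sup |g| + sup |Dg| + [Dg]\<^sub>\<alpha>\<close> on \<open>B\<close>, where \<open>Dg\<close> is meant to be the gradient of \<open>g\<close>.
  Suprema are taken in \<open>ennreal\<close>, so unbounded functions have infinite norm and a supremum
  over the empty set is 0.\<close>

definition C1_holder_norm ::
  "'a::euclidean_space set \<Rightarrow> real \<Rightarrow> ('a \<Rightarrow> real) \<Rightarrow> ('a \<Rightarrow> 'a) \<Rightarrow> ennreal"
  where "C1_holder_norm B \<alpha> g Dg =
    (SUP y\<in>B. ennreal \<bar>g y\<bar>) + (SUP y\<in>B. ennreal (norm (Dg y))) +
    (SUP y\<in>B. SUP z\<in>B - {y}. ennreal (norm (Dg y - Dg z) / dist y z powr \<alpha>))"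

text \<open>The \<open>(n-1)\<close>-dimensional ball of radius \<open>r\<close>, as a subset of the hyperplane orthogonal to the
  unit vector \<open>e\<close>, which plays the role of \<open>e\<^sub>n\<close>.\<close>

definition hyperplane_ball :: "'a::euclidean_space \<Rightarrow> real \<Rightarrow> 'a set"
  where "hyperplane_ball e r = {y. y \<bullet> e = 0 \<and> norm y < r}"

text \<open>In \<open>B\<^sub>2\<close>, the set \<open>\<Omega>\<close> is the region \<open>x\<^sub>n > g x'\<close> above a graph with \<open>C\<^sup>1\<^sup>,\<^sup>\<alpha>\<close> norm at most one;
  hence \<open>frontier \<Omega> \<inter> ball 0 2\<close> is that graph. \<open>g 0 = 0\<close> means that \<open>0\<close> is a boundary point, and
  \<open>Dg 0 = 0\<close> that the outer unit normal \<open>(Dg, -1) / sqrt (1 + |Dg|\<^sup>2)\<close> at \<open>0\<close> equals \<open>-e\<close>. The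
  constraint \<open>Dg y \<bullet> e = 0\<close> makes \<open>Dg\<close> the gradient in the hyperplane. Outside \<open>B\<^sub>2\<close> the set \<open>\<Omega>\<close> is
  arbitrary.\<close>

definition C1_holder_domain :: "'a::euclidean_space \<Rightarrow> real \<Rightarrow> 'a set \<Rightarrow> bool"
  where "C1_holder_domain e \<alpha> \<Omega> \<longleftrightarrow>
    (\<exists>g Dg.
      (\<forall>y\<in>hyperplane_ball e 2. Dg y \<bullet> e = 0 \<and>
         (g has_derivative (\<lambda>h. Dg y \<bullet> h)) (at y within hyperplane_ball e 2)) \<and>
      C1_holder_norm (hyperplane_ball e 2) \<alpha> g Dg \<le> 1 \<and>
      g 0 = 0 \<and> Dg 0 = 0 \<and>
      \<Omega> \<inter> ball 0 2 = {x \<in> ball 0 2. g (x - (x \<bullet> e) *\<^sub>R e) < x \<bullet> e})"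

definition radial_mollifier :: "('a::euclidean_space \<Rightarrow> real) \<Rightarrow> bool"
  where "radial_mollifier \<phi> \<longleftrightarrow>
    (\<forall>k. Ck_on k \<phi> UNIV) \<and>
    (\<exists>K. compact K \<and> K \<subseteq> ball 0 1 \<and> (\<forall>x. x \<notin> K \<longrightarrow> \<phi> x = 0)) \<and>
    (\<forall>x y. norm x = norm y \<longrightarrow> \<phi> x = \<phi> y) \<and>
    (\<forall>x. 0 \<le> \<phi> x) \<and>
    (LINT x|lborel. \<phi> x) = 1"

definition dist_avg :: "('a::euclidean_space \<Rightarrow> real) \<Rightarrow> 'a set \<Rightarrow> 'a \<Rightarrow> real \<Rightarrow> real"
  where "dist_avg \<phi> \<Omega> x t =
    (LINT z:ball 0 1|lborel. infdist (x - (t / 2) *\<^sub>R z) (frontier \<Omega>) * \<phi> z)"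

text \<open>For a mollifier \<open>\<phi>\<close>, the map \<open>t \<mapsto> dist_avg \<phi> \<Omega> x t\<close> is \<open>1/2\<close>-Lipschitz on the real line, so the
  defining equation has exactly one solution.\<close>

definition reg_dist :: "('a::euclidean_space \<Rightarrow> real) \<Rightarrow> 'a set \<Rightarrow> 'a \<Rightarrow> real"
  where "reg_dist \<phi> \<Omega> x = (THE t. t = dist_avg \<phi> \<Omega> x t)"

definition viscosity_subsolution ::
  "'a::euclidean_space set \<Rightarrow> ('a \<Rightarrow> real) \<Rightarrow> ('a \<Rightarrow> real) \<Rightarrow> bool"
  where "viscosity_subsolution U V v \<longleftrightarrow>
    (\<forall>x\<in>U. \<forall>N \<psi>. open N \<and> x \<in> N \<and> N \<subseteq> U \<and> Ck_on 2 \<psi> N \<and>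
       \<psi> x = v x \<and> (\<forall>y\<in>N. v y \<le> \<psi> y)
       \<longrightarrow> - laplacian \<psi> x + V x * v x \<le> 0)"

definition theta_minus :: "real \<Rightarrow> real"
  where "theta_minus \<kappa> = (1 - sqrt (1 + 4 * \<kappa>)) / 2"

text \<open>The condition \<open>lim f \<le> 0\<close> as \<open>x\<close> tends to the boundary, for \<open>f\<close> defined on \<open>\<Omega> \<inter> B\<^sub>1\<close>, is a condition on
  the upper limit of \<open>f\<close> at every point of the boundary in \<open>B\<^sub>1\<close>; no limit is required to exist.\<close>

definition boundary_limsup_nonpos :: "'a::euclidean_space set \<Rightarrow> ('a \<Rightarrow> real) \<Rightarrow> bool"
  where "boundary_limsup_nonpos \<Omega> f \<longleftrightarrow>
    (\<forall>p\<in>frontier \<Omega> \<inter> ball 0 1.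
       Limsup (at p within \<Omega> \<inter> ball 0 1) (\<lambda>x. ereal (f x)) \<le> 0)"

end

theory Submission
  imports Defs
begin

text \<open>The regularity of the regularized distance is not needed. Above the graph of \<open>g\<close>, with
  \<open>N = (-Dg, 1)\<close>, it equals \<open>(x\<^sub>n - g x') / |N|\<close> up to a relative error \<open>d\<^sup>\<alpha>\<close>, because a radial
  mollifier reproduces affine functions. The tangent planes of the graph, corrected by a paraboloid
  of opening \<open>d\<^sup>\<alpha>\<^sup>-\<^sup>1\<close>, form a family of quadratic polynomials whose envelope has the same property.
  If \<open>F\<close> is a positive one-variable function with \<open>F'' < \<kappa> F / t\<^sup>2\<close>, by a margin that absorbs
  the relative error \<open>t\<^sup>\<alpha>\<close>, and of the size of the boundary condition as \<open>t\<close> tends to 0, then one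
  maximizes \<open>v x / F (Q x)\<close> over the points \<open>x\<close> and the polynomials \<open>Q\<close> of the family at once. The
  boundary condition forces a positive maximum into the interior, and the maximizing polynomial
  stays admissible near the maximum point, so a multiple of \<open>F \<circ> Q\<close> touches \<open>v\<close> from above
  there and violates the subsolution property.\<close>

section \<open>The domain above the graph\<close>

text \<open>For negative \<kappa> the zero-order term has the wrong sign for a maximum principle on
  \<open>v\<close> itself; the quotient of \<open>v\<close> by a positive strict supersolution obeys
  one whatever the sign. The strictness must pay for geometric errors of relative size
  \<open>t powr \<alpha>\<close>. Multiplying the leading profile,
  \<open>t powr theta_minus \<kappa>\<close> or \<open>t powr (1 / 2) * \<bar>ln t\<bar>\<close>, by
  the exponential of a multiple of \<open>t powr \<epsilon>\<close> with \<epsilon> < \<alpha> gains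
  a margin of order \<open>t powr \<epsilon>\<close>, which wins for small \<open>t\<close> and
  leaves the growth at 0 comparable, so that the boundary condition still applies. The radius must
  not depend on \<kappa>, although the gap \<open>sqrt (1 + 4 * \<kappa>)\<close> between the roots
  of \<theta>^2 - \<theta> = \<kappa> closes at -1/4 and the coefficients grow with \<kappa>. Hence
  the perturbation is chosen by regime, on one common interval.\<close>

lemma powr_Suc_exponent: "0 \<le> x \<Longrightarrow> x powr (1 + a) = x * x powr a" for x a :: real
  by (simp add: powr_mult_base)

lemma scaled_powr_le:
  fixes x u k a :: real
  assumes "0 \<le> x" "x \<le> k * u" "0 \<le> u" "1 \<le> k" "0 \<le> a" "a \<le> 1"
  shows "x powr a \<le> k * u powr a"
proof -
  have "x powr a \<le> (k * u) powr a" by (rule powr_mono2) (use assms in auto)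
  also have "\<dots> = k powr a * u powr a" using assms by (simp add: powr_mult)
  also have "\<dots> \<le> k powr 1 * u powr a"
    by (intro mult_right_mono powr_mono) (use assms in auto)
  finally show ?thesis using assms by simp
qed

lemma scaled_powr_Suc_le:
  fixes x u k a :: real
  assumes "0 \<le> x" "x \<le> k * u" "0 \<le> u" "1 \<le> k" "0 \<le> a" "a \<le> 1"
  shows "x powr (1 + a) \<le> k\<^sup>2 * u powr (1 + a)"
proof -
  have "x * x powr a \<le> (k * u) * (k * u powr a)"
    by (rule mult_mono) (use assms scaled_powr_le[OF assms] in auto)
  then show ?thesis using assms by (simp add: powr_Suc_exponent power2_eq_square algebra_simps)
qed

lemma C1_holder_norm_le1D:
  assumes norm_le: "C1_holder_norm B \<alpha> g Dg \<le> 1" and y: "y \<in> B"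
  shows "norm (Dg y) \<le> 1"
    and "z \<in> B \<Longrightarrow> norm (Dg y - Dg z) \<le> dist y z powr \<alpha>"
proof -
  let ?b = "SUP y\<in>B. ennreal (norm (Dg y))"
  let ?c = "SUP y\<in>B. SUP z\<in>B - {y}. ennreal (norm (Dg y - Dg z) / dist y z powr \<alpha>)"
  have "?b \<le> C1_holder_norm B \<alpha> g Dg"
    unfolding C1_holder_norm_def by (meson add_increasing add_increasing2 order_refl zero_le)
  moreover have "ennreal (norm (Dg y)) \<le> ?b" using y by (rule SUP_upper)
  ultimately have "ennreal (norm (Dg y)) \<le> 1" using norm_le by order
  then show "norm (Dg y) \<le> 1" by simp
  show "norm (Dg y - Dg z) \<le> dist y z powr \<alpha>" if z: "z \<in> B"
  proof (cases "y = z")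
    case False
    have "?c \<le> C1_holder_norm B \<alpha> g Dg"
      unfolding C1_holder_norm_def by (meson add_increasing order_refl zero_le)
    moreover have "ennreal (norm (Dg y - Dg z) / dist y z powr \<alpha>) \<le> ?c"
      by (rule SUP_upper2[OF y], rule SUP_upper) (use z False in auto)
    ultimately have "ennreal (norm (Dg y - Dg z) / dist y z powr \<alpha>) \<le> 1" using norm_le by order
    then have "norm (Dg y - Dg z) / dist y z powr \<alpha> \<le> 1" by simp
    then show ?thesis using False by (simp add: divide_simps split: if_splits)
  qed simp
qed

locale graph_domain =
  fixes e :: "'a::euclidean_space" and \<alpha> :: real and g :: "'a \<Rightarrow> real" and Dg :: "'a \<Rightarrow> 'a"
    and \<Omega> :: "'a set"
  assumes e_Basis: "e \<in> Basis"
    and \<alpha>_pos: "0 < \<alpha>" and \<alpha>_less: "\<alpha> < 1"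
    and Dg_orth: "y \<in> hyperplane_ball e 2 \<Longrightarrow> Dg y \<bullet> e = 0"
    and g_deriv: "y \<in> hyperplane_ball e 2 \<Longrightarrow>
      (g has_derivative (\<lambda>h. Dg y \<bullet> h)) (at y within hyperplane_ball e 2)"
    and Dg_le: "y \<in> hyperplane_ball e 2 \<Longrightarrow> norm (Dg y) \<le> 1"
    and Dg_holder: "y \<in> hyperplane_ball e 2 \<Longrightarrow> z \<in> hyperplane_ball e 2 \<Longrightarrow>
      norm (Dg y - Dg z) \<le> dist y z powr \<alpha>"
    and g_0: "g 0 = 0"
    and \<Omega>_eq: "\<Omega> \<inter> ball 0 2 = {x \<in> ball 0 2. g (x - (x \<bullet> e) *\<^sub>R e) < x \<bullet> e}"

lemma C1_holder_domain_imp_graph_domain: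
  assumes "C1_holder_domain e \<alpha> \<Omega>" "e \<in> Basis" "0 < \<alpha>" "\<alpha> < 1"
  obtains g Dg where "graph_domain e \<alpha> g Dg \<Omega>"
proof -
  from assms(1) obtain g Dg where *:
    "\<forall>y\<in>hyperplane_ball e 2. Dg y \<bullet> e = 0 \<and>
       (g has_derivative (\<lambda>h. Dg y \<bullet> h)) (at y within hyperplane_ball e 2)"
    "C1_holder_norm (hyperplane_ball e 2) \<alpha> g Dg \<le> 1"
    "g 0 = 0" "\<Omega> \<inter> ball 0 2 = {x \<in> ball 0 2. g (x - (x \<bullet> e) *\<^sub>R e) < x \<bullet> e}"
    unfolding C1_holder_domain_def by blast
  have "graph_domain e \<alpha> g Dg \<Omega>"
    by unfold_locales (use * assms C1_holder_norm_le1D[OF *(2)] in auto)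
  then show ?thesis by (rule that)
qed

context graph_domain
begin

definition proj :: "'a \<Rightarrow> 'a" where "proj x = x - (x \<bullet> e) *\<^sub>R e"

definition height :: "'a \<Rightarrow> real" where "height x = x \<bullet> e - g (proj x)"

text \<open>The gradient of \<open>height\<close>: the normal of the graph at the point on the
  vertical line through \<open>x\<close>, pointing into \<Omega> and scaled to have component 1
  along \<open>e\<close>, not length 1.\<close>

definition nrm :: "'a \<Rightarrow> 'a" where "nrm x = e - Dg (proj x)"

definition slope :: "'a \<Rightarrow> real" where "slope x = norm (nrm x)"

text \<open>First-order Taylor polynomial of \<open>height\<close> at \<open>z\<close>. It vanishes
  on the tangent plane of the graph at the point vertically below \<open>z\<close>, and
  \<open>tangent z x / slope z\<close> is the signed distance of \<open>x\<close> to that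
  plane.\<close>

definition tangent :: "'a \<Rightarrow> 'a \<Rightarrow> real" where "tangent z x = height z + nrm z \<bullet> (x - z)"

lemma e_e [simp]: "e \<bullet> e = 1" and norm_e [simp]: "norm e = 1"
  using e_Basis by (auto simp: inner_same_Basis)

lemma proj_diff: "proj x - proj y = proj (x - y)"
  by (simp add: proj_def inner_diff_left scaleR_diff_left)

lemma proj_orth [simp]: "proj x \<bullet> e = 0"
  by (simp add: proj_def inner_diff_left)

lemma norm_proj_le: "norm (proj x) \<le> norm x"
proof -
  have "x \<bullet> x = proj x \<bullet> proj x + (x \<bullet> e)\<^sup>2"
    by (simp add: proj_def inner_diff_left inner_diff_right inner_commute power2_eq_square)
  then have "proj x \<bullet> proj x \<le> x \<bullet> x" by simp
  then show ?thesis by (simp add: norm_eq_sqrt_inner)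
qed

lemma proj_mem: "norm x < 2 \<Longrightarrow> proj x \<in> hyperplane_ball e 2"
  using norm_proj_le[of x] by (simp add: hyperplane_ball_def)

lemma convex_hyperplane_ball: "convex (hyperplane_ball e 2)"
proof -
  have "hyperplane_ball e 2 = {y. e \<bullet> y = 0} \<inter> ball 0 2"
    by (auto simp: hyperplane_ball_def inner_commute)
  then show ?thesis by (simp add: convex_Int convex_hyperplane)
qed

lemma onorm_inner_le: "onorm (\<lambda>h. c \<bullet> h) \<le> norm c" for c :: 'a
  by (rule onorm_le) (simp add: Cauchy_Schwarz_ineq2)

lemma nrm_holder:
  assumes "norm x < 2" "norm z < 2"
  shows "norm (nrm x - nrm z) \<le> norm (x - z) powr \<alpha>"
proof -
  have "norm (nrm x - nrm z) = norm (Dg (proj x) - Dg (proj z))"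
    by (simp add: nrm_def norm_minus_commute)
  also have "\<dots> \<le> dist (proj x) (proj z) powr \<alpha>"
    by (rule Dg_holder) (use assms proj_mem in auto)
  also have "\<dots> \<le> norm (x - z) powr \<alpha>"
    by (rule powr_mono2) (use \<alpha>_pos norm_proj_le in \<open>auto simp: dist_norm proj_diff\<close>)
  finally show ?thesis .
qed

lemma slope_bounds:
  assumes "norm x < 2"
  shows "1 \<le> slope x" "slope x \<le> 2"
proof -
  have *: "Dg (proj x) \<bullet> e = 0" "norm (Dg (proj x)) \<le> 1"
    using proj_mem[OF assms] Dg_orth Dg_le by auto
  have "nrm x \<bullet> e = 1" using * by (simp add: nrm_def inner_diff_left)
  then show "1 \<le> slope x" unfolding slope_def using Cauchy_Schwarz_ineq2[of "nrm x" e] by simp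
  show "slope x \<le> 2" unfolding slope_def nrm_def
    using norm_triangle_ineq4[of e "Dg (proj x)"] * by simp
qed

text \<open>Mean value inequality on a segment of the hyperplane, along which \<open>Dg\<close>
  stays within \<open>norm (x - z) powr \<alpha>\<close> of its value at \<open>proj z\<close>. The
  vertical direction adds no error, \<open>height\<close> being affine in it.\<close>

lemma height_tangent:
  assumes "norm x < 2" "norm z < 2"
  shows "\<bar>height x - tangent z x\<bar> \<le> norm (x - z) powr (1 + \<alpha>)"
proof -
  let ?x = "proj x" and ?z = "proj z"
  have mem: "?x \<in> hyperplane_ball e 2" "?z \<in> hyperplane_ball e 2" using assms proj_mem by auto
  then have sub: "closed_segment ?z ?x \<subseteq> hyperplane_ball e 2"
    by (intro closed_segment_subset convex_hyperplane_ball)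
  have "norm (g ?x - g ?z - Dg ?z \<bullet> (?x - ?z)) \<le> norm (?x - ?z) * norm (?x - ?z) powr \<alpha>"
  proof (rule differentiable_bound_linearization[where S = "closed_segment ?z ?x"
        and f' = "\<lambda>y h. Dg y \<bullet> h" and ?x0.0 = ?z])
    fix y assume y: "y \<in> closed_segment ?z ?x"
    show "(g has_derivative (\<lambda>h. Dg y \<bullet> h)) (at y within closed_segment ?z ?x)"
      using g_deriv[of y] sub y by (meson has_derivative_subset subsetD)
    have "onorm ((\<lambda>h. Dg y \<bullet> h) - (\<lambda>h. Dg ?z \<bullet> h)) \<le> norm (Dg y - Dg ?z)"
      using onorm_inner_le[of "Dg y - Dg ?z"] by (simp add: inner_diff_left fun_diff_def)
    also have "\<dots> \<le> dist y ?z powr \<alpha>" using y sub mem by (intro Dg_holder) auto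
    also have "\<dots> \<le> norm (?x - ?z) powr \<alpha>"
      using dist_in_closed_segment[OF y] \<alpha>_pos
      by (intro powr_mono2) (auto simp: dist_norm norm_minus_commute)
    finally show "onorm ((\<lambda>h. Dg y \<bullet> h) - (\<lambda>h. Dg ?z \<bullet> h)) \<le> norm (?x - ?z) powr \<alpha>" .
  next
    show "?z + t *\<^sub>R (?x - ?z) \<in> closed_segment ?z ?x" if "t \<in> {0..1}" for t
      using that by (auto simp: in_segment algebra_simps intro!: exI[of _ t])
  qed auto
  also have "\<dots> = norm (?x - ?z) powr (1 + \<alpha>)" by (simp add: powr_Suc_exponent)
  also have "\<dots> \<le> norm (x - z) powr (1 + \<alpha>)"
    using \<alpha>_pos norm_proj_le[of "x - z"] by (intro powr_mono2) (auto simp: proj_diff)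
  also have "g ?x - g ?z - Dg ?z \<bullet> (?x - ?z) = - (height x - tangent z x)"
    using Dg_orth[OF mem(2)]
    by (simp add: height_def tangent_def nrm_def proj_def inner_diff_left inner_diff_right
        inner_commute)
  finally show ?thesis by (simp add: abs_minus_commute)
qed

lemma height_lipschitz:
  assumes "norm x < 2" "norm y < 2"
  shows "\<bar>height x - height y\<bar> \<le> 2 * norm (x - y)"
proof -
  let ?x = "proj x" and ?y = "proj y"
  have mem: "?x \<in> hyperplane_ball e 2" "?y \<in> hyperplane_ball e 2" using assms proj_mem by auto
  have "norm (g ?x - g ?y) \<le> 1 * norm (?x - ?y)"
    by (rule differentiable_bound[OF convex_hyperplane_ball g_deriv _ mem])
      (use onorm_inner_le Dg_le order_trans in blast)+
  also have "norm (?x - ?y) \<le> norm (x - y)" using norm_proj_le[of "x - y"] by (simp add: proj_diff)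
  finally have "\<bar>g ?x - g ?y\<bar> \<le> norm (x - y)" by simp
  moreover have "\<bar>(x - y) \<bullet> e\<bar> \<le> norm (x - y)" using Cauchy_Schwarz_ineq2[of "x - y" e] by simp
  ultimately show ?thesis unfolding height_def inner_diff_left by linarith
qed

lemma height_0 [simp]: "height 0 = 0"
  by (simp add: height_def proj_def g_0)

lemma height_le: "norm x < 2 \<Longrightarrow> \<bar>height x\<bar> \<le> 2 * norm x"
  using height_lipschitz[of x 0] by simp

lemma continuous_on_height: "continuous_on (ball 0 2) height"
  by (rule continuous_on_compose2[of UNIV "\<lambda>x. x", simplified],
      rule lipschitz_on_continuous_on[of 2], rule lipschitz_onI)
    (use height_lipschitz in \<open>auto simp: dist_norm\<close>)

lemma continuous_on_nrm: "continuous_on (ball 0 2) nrm"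
proof (rule continuous_onI)
  fix x :: 'a and \<epsilon> :: real
  assume x: "x \<in> ball 0 2" and \<epsilon>: "0 < \<epsilon>"
  show "\<exists>d>0. \<forall>y\<in>ball 0 2. dist y x < d \<longrightarrow> dist (nrm y) (nrm x) \<le> \<epsilon>"
  proof (intro exI[of _ "\<epsilon> powr (1 / \<alpha>)"] conjI ballI impI)
    fix y :: 'a assume y: "y \<in> ball 0 2" "dist y x < \<epsilon> powr (1 / \<alpha>)"
    have "dist (nrm y) (nrm x) \<le> norm (y - x) powr \<alpha>" using nrm_holder x y by (auto simp: dist_norm)
    also have "\<dots> \<le> (\<epsilon> powr (1 / \<alpha>)) powr \<alpha>"
      using y \<alpha>_pos by (intro powr_mono2) (auto simp: dist_norm)
    also have "\<dots> = \<epsilon>" using \<epsilon> \<alpha>_pos by (simp add: powr_powr)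
    finally show "dist (nrm y) (nrm x) \<le> \<epsilon>" .
  qed (use \<epsilon> in auto)
qed

lemma mem_\<Omega>_iff: "norm x < 2 \<Longrightarrow> x \<in> \<Omega> \<longleftrightarrow> 0 < height x"
  using \<Omega>_eq by (auto simp: height_def proj_def set_eq_iff)

lemma open_\<Omega>_Int_ball: "r \<le> 2 \<Longrightarrow> open (\<Omega> \<inter> ball 0 r)"
proof -
  assume r: "r \<le> 2"
  have "open {x \<in> ball 0 2. height x \<in> {0<..}}"
    using continuous_open_preimage[OF continuous_on_height, of "{0<..}"]
    by (simp add: vimage_def Int_def)
  then have "open ({x \<in> ball 0 2. height x \<in> {0<..}} \<inter> ball 0 r)" by blast
  also have "{x \<in> ball 0 2. height x \<in> {0<..}} \<inter> ball 0 r = \<Omega> \<inter> ball 0 r"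
    using mem_\<Omega>_iff r by auto
  finally show ?thesis .
qed

lemma height_add_e: "height (x + s *\<^sub>R e) = height x + s"
  by (simp add: height_def proj_def inner_add_left algebra_simps)

text \<open>Vertical translation by \<open>s\<close> raises \<open>height\<close> by exactly
  \<open>s\<close>, so a point of zero height is a limit of points above the graph; where
  \<open>height\<close> is nonzero, its sign is locally constant.\<close>

lemma mem_frontier_iff:
  assumes "norm p < 2"
  shows "p \<in> frontier \<Omega> \<longleftrightarrow> height p = 0"
proof
  assume "height p = 0"
  have "p \<in> closure \<Omega>"
  proof (subst closure_approachable, intro allI impI)
    fix \<epsilon> :: real assume \<epsilon>: "0 < \<epsilon>"
    define s where "s = min (\<epsilon> / 2) ((2 - norm p) / 2)"
    have s: "0 < s" "s < \<epsilon>" "s < 2 - norm p" using assms \<epsilon> by (auto simp: s_def min_def)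
    have "norm (p + s *\<^sub>R e) < 2" using norm_triangle_ineq[of p "s *\<^sub>R e"] s by simp
    then have "p + s *\<^sub>R e \<in> \<Omega>" using \<open>height p = 0\<close> s by (simp add: mem_\<Omega>_iff height_add_e)
    then show "\<exists>y\<in>\<Omega>. dist y p < \<epsilon>" using s by (intro bexI[of _ "p + s *\<^sub>R e"]) (auto simp: dist_norm)
  qed
  moreover have "p \<notin> interior \<Omega>"
    using mem_\<Omega>_iff[OF assms] \<open>height p = 0\<close> interior_subset[of \<Omega>] by auto
  ultimately show "p \<in> frontier \<Omega>" by (simp add: frontier_def)
next
  assume p: "p \<in> frontier \<Omega>"
  have ball: "open (ball (0::'a) 2)" "p \<in> ball 0 2" using assms by auto
  have "\<not> 0 < height p"
  proof
    assume "0 < height p"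
    then have "p \<in> \<Omega> \<inter> ball 0 2" using assms mem_\<Omega>_iff by auto
    then have "p \<in> interior \<Omega>" using open_\<Omega>_Int_ball[of 2] by (auto simp: interior_def)
    then show False using p by (simp add: frontier_def)
  qed
  moreover have "\<not> height p < 0"
  proof
    assume h: "height p < 0"
    have "open {x \<in> ball 0 2. height x \<in> {..<0}}"
      using continuous_open_preimage[OF continuous_on_height, of "{..<0}"]
      by (simp add: vimage_def Int_def)
    moreover have "p \<in> {x \<in> ball 0 2. height x \<in> {..<0}}" using h assms by auto
    moreover have "\<Omega> \<inter> {x \<in> ball 0 2. height x \<in> {..<0}} = {}" using mem_\<Omega>_iff by force
    ultimately have "p \<notin> closure \<Omega>"
      by (metis (no_types, lifting) disjoint_iff open_Int_closure_eq_empty inf_commute)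
    then show False using p by (simp add: frontier_def)
  qed
  ultimately show "height p = 0" by simp
qed

text \<open>The map \<open>s \<mapsto> 1 / s\<close> is 1-Lipschitz for \<open>s \<ge> 1\<close>, so
  the bound on the normals passes to their inverse lengths.\<close>

lemma inverse_slope_holder:
  assumes "norm x < 2" "norm z < 2"
  shows "\<bar>1 / slope x - 1 / slope z\<bar> \<le> norm (x - z) powr \<alpha>"
proof -
  have s: "1 \<le> slope x" "1 \<le> slope z" using slope_bounds assms by auto
  have "1 / slope x - 1 / slope z = (slope z - slope x) / (slope x * slope z)"
    using s by (simp add: field_simps)
  then have "\<bar>1 / slope x - 1 / slope z\<bar> = \<bar>slope z - slope x\<bar> / (slope x * slope z)"
    using s by (simp add: abs_mult)
  also have "\<dots> \<le> \<bar>slope z - slope x\<bar> / 1"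
    using s mult_mono[of 1 "slope x" 1 "slope z"] by (intro divide_left_mono) auto
  also have "\<dots> \<le> norm (nrm x - nrm z)"
    unfolding slope_def using norm_triangle_ineq3[of "nrm x" "nrm z"] by (simp add: abs_minus_commute)
  also have "\<dots> \<le> norm (x - z) powr \<alpha>" by (rule nrm_holder[OF assms])
  finally show ?thesis .
qed

text \<open>Two errors add up: the Taylor remainder of \<open>height\<close>, divided by a slope of
  at least 1, and the variation of \<open>1 / slope\<close> between the base points, weighted with
  \<open>height x\<close>.\<close>

lemma tangent_height_quotient:
  assumes "norm x < 2" "norm z < 2"
  shows "\<bar>tangent z x / slope z - height x / slope x\<bar>
    \<le> norm (x - z) powr (1 + \<alpha>) + \<bar>height x\<bar> * norm (x - z) powr \<alpha>"
proof -
  have s: "1 \<le> slope z" using slope_bounds assms by auto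
  have "tangent z x / slope z - height x / slope x =
      (tangent z x - height x) / slope z + height x * (1 / slope z - 1 / slope x)"
    by (simp add: algebra_simps diff_divide_distrib)
  also have "\<bar>\<dots>\<bar> \<le> \<bar>(tangent z x - height x) / slope z\<bar> + \<bar>height x * (1 / slope z - 1 / slope x)\<bar>"
    by (rule abs_triangle_ineq)
  also have "\<dots> \<le> norm (x - z) powr (1 + \<alpha>) + \<bar>height x\<bar> * norm (x - z) powr \<alpha>"
  proof (rule add_mono)
    have "\<bar>(tangent z x - height x) / slope z\<bar> \<le> \<bar>tangent z x - height x\<bar> / 1"
      unfolding abs_divide using s by (intro divide_left_mono) auto
    then show "\<bar>(tangent z x - height x) / slope z\<bar> \<le> norm (x - z) powr (1 + \<alpha>)"
      using height_tangent[OF assms] by (simp add: abs_minus_commute)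
    show "\<bar>height x * (1 / slope z - 1 / slope x)\<bar> \<le> \<bar>height x\<bar> * norm (x - z) powr \<alpha>"
      using inverse_slope_holder[OF assms(1,2)]
      by (simp add: abs_mult abs_minus_commute mult_left_mono)
  qed
  finally show ?thesis .
qed

lemma tangent_self [simp]: "tangent x x = height x"
  by (simp add: tangent_def)

lemma tangent_lipschitz: "\<bar>tangent x y - tangent x z\<bar> \<le> slope x * norm (y - z)"
proof -
  have "tangent x y - tangent x z = nrm x \<bullet> (y - z)" by (simp add: tangent_def inner_diff_right)
  then show ?thesis using Cauchy_Schwarz_ineq2[of "nrm x" "y - z"] by (simp add: slope_def)
qed

text \<open>\<open>\<bar>tangent x y\<bar> / slope x\<close> is the exact distance from
  \<open>y\<close> to the tangent plane. All points compared lie within \<open>5 * height x\<close>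
  of \<open>x\<close>: 2 for reaching \<open>y\<close>, 3 for leaving it. There plane and graph
  differ by at most \<open>(5 * height x) powr (1 + \<alpha>)\<close>, whence the 25.\<close>

lemma infdist_tangent_bounds:
  assumes x: "norm x \<le> 1 / 20" "0 < height x" and y: "norm (y - x) \<le> 2 * height x"
  shows "infdist y (frontier \<Omega>) \<le> \<bar>tangent x y\<bar> / slope x + 25 * height x powr (1 + \<alpha>)"
    and "tangent x y / slope x - 25 * height x powr (1 + \<alpha>) \<le> infdist y (frontier \<Omega>)"
proof -
  let ?u = "height x" and ?n = "slope x" and ?l = "tangent x y"
  have u: "?u \<le> 1 / 10" using height_le[of x] x by auto
  have n: "1 \<le> ?n" using slope_bounds[of x] x by auto
  have nsq: "nrm x \<bullet> nrm x = ?n\<^sup>2" by (simp add: slope_def power2_norm_eq_inner)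
  have le: "\<bar>?l\<bar> / ?n \<le> 3 * ?u"
  proof -
    have "\<bar>?l\<bar> \<le> ?u + ?n * norm (y - x)" using tangent_lipschitz[of x y x] x by simp
    also have "\<dots> \<le> ?n * ?u + ?n * (2 * ?u)" using n x y by (intro add_mono mult_left_mono) auto
    finally show ?thesis using n by (simp add: divide_simps algebra_simps)
  qed
  have small: "norm (b - x) powr (1 + \<alpha>) \<le> 25 * ?u powr (1 + \<alpha>)" if "norm (b - x) \<le> 5 * ?u" for b
    using scaled_powr_Suc_le[of "norm (b - x)" 5 ?u \<alpha>] that x \<alpha>_pos \<alpha>_less by simp
  show "infdist y (frontier \<Omega>) \<le> \<bar>?l\<bar> / ?n + 25 * ?u powr (1 + \<alpha>)"
  proof -
    \<comment> \<open>Foot of the perpendicular from \<open>y\<close> to the tangent plane.\<close>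
    define b where "b = y - (?l / ?n\<^sup>2) *\<^sub>R nrm x"
    have yb: "norm (y - b) = \<bar>?l\<bar> / ?n"
      using n by (simp add: b_def slope_def[symmetric] power2_eq_square)
    have "norm (b - x) \<le> norm (y - b) + norm (y - x)"
      using norm_triangle_ineq4[of "y - x" "y - b"] by simp
    then have bx: "norm (b - x) \<le> 5 * ?u" using yb le y by linarith
    have bn: "norm b \<le> 11 / 20" using norm_triangle_ineq[of "b - x" x] bx u x by simp
    have "tangent x b = ?l + nrm x \<bullet> (b - y)" by (simp add: tangent_def inner_diff_right)
    also have "\<dots> = 0" using n by (simp add: b_def nsq)
    finally have hb: "\<bar>height b\<bar> \<le> 25 * ?u powr (1 + \<alpha>)"
      using height_tangent[of b x] small[OF bx] bn x by auto
    \<comment> \<open>Vertical move from the plane to the graph; its length is the Taylor remainder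
      at \<open>b\<close>.\<close>
    define p where "p = b + (- height b) *\<^sub>R e"
    have "norm p \<le> norm b + \<bar>height b\<bar>" unfolding p_def using norm_triangle_ineq[of b "(- height b) *\<^sub>R e"] by simp
    then have "norm p < 2" using height_le[of b] bn by linarith
    moreover have "height p = 0" unfolding p_def by (simp only: height_add_e)
    ultimately have "p \<in> frontier \<Omega>" by (simp add: mem_frontier_iff)
    then have "infdist y (frontier \<Omega>) \<le> dist y p" by (rule infdist_le)
    also have "\<dots> \<le> norm (y - b) + norm (b - p)" unfolding dist_norm by (metis norm_triangle_ineq diff_add_cancel add_diff_eq)
    also have "norm (b - p) = \<bar>height b\<bar>" by (simp add: p_def)
    finally show ?thesis using yb hb by linarith
  qed
  show "?l / ?n - 25 * ?u powr (1 + \<alpha>) \<le> infdist y (frontier \<Omega>)"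
  proof -
    have "0 \<in> frontier \<Omega>" by (simp add: mem_frontier_iff)
    then have ne: "frontier \<Omega> \<noteq> {}" by auto
    have "?l / ?n - 25 * ?u powr (1 + \<alpha>) \<le> dist y p" if p: "p \<in> frontier \<Omega>" for p
    \<comment> \<open>Frontier points far from \<open>y\<close>, among them all those outside
      \<open>ball 0 2\<close> where \<Omega> is arbitrary, fall under the second case: they are
      farther away than the tangent plane.\<close>
    proof (cases "dist y p \<le> 3 * ?u")
      case True
      have "norm (p - x) \<le> dist y p + norm (y - x)"
        using norm_triangle_ineq4[of "y - x" "y - p"] by (simp add: dist_norm)
      then have px: "norm (p - x) \<le> 5 * ?u" using True y by linarith
      then have "norm p < 2" using norm_triangle_ineq[of "p - x" x] u x by simp
      then have "\<bar>tangent x p\<bar> \<le> 25 * ?u powr (1 + \<alpha>)"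
        using height_tangent[of p x] small[OF px] p mem_frontier_iff[of p] x by auto
      then have "?l \<le> 25 * ?u powr (1 + \<alpha>) + ?n * dist y p"
        using tangent_lipschitz[of x y p] by (simp add: dist_norm)
      then have "?l / ?n \<le> 25 * ?u powr (1 + \<alpha>) / ?n + dist y p"
        using n by (simp add: divide_simps algebra_simps)
      also have "25 * ?u powr (1 + \<alpha>) / ?n \<le> 25 * ?u powr (1 + \<alpha>) / 1"
        using n by (intro divide_left_mono) auto
      finally show ?thesis by simp
    next
      case False
      have "?l / ?n \<le> \<bar>?l\<bar> / ?n" using n by (simp add: divide_right_mono)
      moreover have "0 \<le> ?u powr (1 + \<alpha>)" by simp
      ultimately show ?thesis using le False by linarith
    qed
    then show ?thesis unfolding infdist_notempty[OF ne] by (intro cINF_greatest ne)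
  qed
qed

end

section \<open>The regularized distance\<close>

lemma lborel_distr_uminus_euclidean:
  "distr lborel borel uminus = (lborel :: 'a::euclidean_space measure)"
proof -
  have "density (distr lborel borel (\<lambda>x::'a. - x)) (\<lambda>_. 1) = lborel"
    using lborel_affine[of "- 1" "0::'a", symmetric] by simp
  then show ?thesis by (simp add: density_1)
qed

context
  fixes \<phi> :: "'a::euclidean_space \<Rightarrow> real"
  assumes mollifier: "radial_mollifier \<phi>"
begin

lemma mollifier_nonneg: "0 \<le> \<phi> x"
  using mollifier unfolding radial_mollifier_def by blast

lemma mollifier_outside: "x \<notin> ball 0 1 \<Longrightarrow> \<phi> x = 0"
  using mollifier unfolding radial_mollifier_def by blast

lemma mollifier_integrable:
  assumes f: "continuous_on UNIV f"
  shows "integrable lborel (\<lambda>z. f z * \<phi> z)"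
proof -
  obtain K where K: "compact K" "\<And>x. x \<notin> K \<Longrightarrow> \<phi> x = 0"
    using mollifier unfolding radial_mollifier_def by blast
  have "Ck_on 0 \<phi> UNIV" using mollifier unfolding radial_mollifier_def by blast
  then have "continuous_on UNIV (\<lambda>z. f z * \<phi> z)"
    using f by (intro continuous_on_mult) simp_all
  then have "continuous_on K (\<lambda>z. f z * \<phi> z)"
    by (rule continuous_on_subset) simp
  then have "integrable lborel (\<lambda>z. indicator K z *\<^sub>R (f z * \<phi> z))"
    by (rule borel_integrable_compact[OF K(1)])
  also have "(\<lambda>z. indicator K z *\<^sub>R (f z * \<phi> z)) = (\<lambda>z. f z * \<phi> z)"
    using K(2) by (auto simp: indicator_def fun_eq_iff)
  finally show ?thesis .
qed

lemma mollifier_integral: "(LINT z|lborel. \<phi> z) = 1"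
  using mollifier unfolding radial_mollifier_def by blast

text \<open>The integrand is odd under reflection. Radiality enters here, through
  \<open>\<phi> (- z) = \<phi> z\<close>, and makes averages of affine functions exact.\<close>

lemma mollifier_integral_inner: "(LINT z|lborel. (b \<bullet> z) * \<phi> z) = 0"
proof -
  have [measurable]: "\<phi> \<in> borel_measurable borel"
    using borel_measurable_integrable[OF mollifier_integrable[of "\<lambda>_. 1"]] by simp
  have "(LINT z|lborel. (b \<bullet> z) * \<phi> z) = (LINT z|distr lborel borel uminus. (b \<bullet> z) * \<phi> z)"
    by (simp only: lborel_distr_uminus_euclidean)
  also have "\<dots> = (LINT z|lborel. (b \<bullet> (- z)) * \<phi> (- z))"
    by (rule integral_distr) auto
  also have "\<dots> = (LINT z|lborel. - ((b \<bullet> z) * \<phi> z))"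
  proof (rule Bochner_Integration.integral_cong)
    fix z :: 'a
    have "\<phi> (- z) = \<phi> z" using mollifier unfolding radial_mollifier_def by (metis norm_minus_cancel)
    then show "(b \<bullet> (- z)) * \<phi> (- z) = - ((b \<bullet> z) * \<phi> z)" by simp
  qed simp
  finally show ?thesis by simp
qed

lemma mollifier_integral_diff_le:
  assumes f: "continuous_on UNIV f" and h: "continuous_on UNIV h"
    and le: "\<And>z. z \<in> ball 0 1 \<Longrightarrow> \<bar>f z - h z\<bar> \<le> c"
  shows "\<bar>(LINT z|lborel. f z * \<phi> z) - (LINT z|lborel. h z * \<phi> z)\<bar> \<le> c"
proof -
  have int: "integrable lborel (\<lambda>z. (f z - h z) * \<phi> z)"
    by (intro mollifier_integrable continuous_intros f h)
  have "(LINT z|lborel. f z * \<phi> z) - (LINT z|lborel. h z * \<phi> z) = (LINT z|lborel. (f z - h z) * \<phi> z)"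
    using mollifier_integrable[OF f] mollifier_integrable[OF h]
    by (simp add: left_diff_distrib)
  also have "\<bar>\<dots>\<bar> \<le> (LINT z|lborel. \<bar>(f z - h z) * \<phi> z\<bar>)"
    by (rule integral_abs_bound)
  also have "\<dots> \<le> (LINT z|lborel. c * \<phi> z)"
  proof (rule integral_mono)
    show "integrable lborel (\<lambda>z. c * \<phi> z)"
      by (intro mollifier_integrable continuous_intros)
    show "\<bar>(f z - h z) * \<phi> z\<bar> \<le> c * \<phi> z" for z
      using le[of z] mollifier_outside[of z] mollifier_nonneg[of z]
      by (cases "z \<in> ball 0 1") (auto simp: abs_mult mult_right_mono)
  qed (use int in simp)
  finally show ?thesis by (simp add: mollifier_integral)
qed

lemma dist_avg_eq:
  "dist_avg \<phi> \<Omega> x t = (LINT z|lborel. infdist (x - (t / 2) *\<^sub>R z) (frontier \<Omega>) * \<phi> z)"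
  unfolding dist_avg_def set_lebesgue_integral_def
  by (rule Bochner_Integration.integral_cong)
    (use mollifier_outside in \<open>auto simp: indicator_def\<close>)

lemma dist_avg_lipschitz: "\<bar>dist_avg \<phi> \<Omega> x t - dist_avg \<phi> \<Omega> x s\<bar> \<le> \<bar>t - s\<bar> / 2"
  unfolding dist_avg_eq
proof (rule mollifier_integral_diff_le)
  fix z :: 'a assume z: "z \<in> ball 0 1"
  have "\<bar>infdist (x - (t / 2) *\<^sub>R z) (frontier \<Omega>) - infdist (x - (s / 2) *\<^sub>R z) (frontier \<Omega>)\<bar>
      \<le> dist (x - (t / 2) *\<^sub>R z) (x - (s / 2) *\<^sub>R z)"
    by (rule infdist_triangle_abs)
  also have "\<dots> = norm (((s - t) / 2) *\<^sub>R z)"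
    by (simp add: dist_norm scaleR_left_diff_distrib diff_divide_distrib)
  also have "\<dots> = \<bar>t - s\<bar> / 2 * norm z" by (simp add: abs_minus_commute)
  also have "\<dots> \<le> \<bar>t - s\<bar> / 2" using z by (simp add: mult_left_le)
  finally show "\<bar>infdist (x - (t / 2) *\<^sub>R z) (frontier \<Omega>) - infdist (x - (s / 2) *\<^sub>R z) (frontier \<Omega>)\<bar>
      \<le> \<bar>t - s\<bar> / 2" .
qed (auto intro!: continuous_intros)

lemma reg_dist_fixpoint: "reg_dist \<phi> \<Omega> x = dist_avg \<phi> \<Omega> x (reg_dist \<phi> \<Omega> x)"
proof -
  have "\<exists>!t. dist_avg \<phi> \<Omega> x t = t"
    by (rule banach_fix_type[of "1 / 2"])
      (use dist_avg_lipschitz[of \<Omega> x] in \<open>auto simp: dist_real_def\<close>)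
  then have "\<exists>!t. t = dist_avg \<phi> \<Omega> x t" by metis
  then show ?thesis unfolding reg_dist_def by (rule theI')
qed

text \<open>Compares the averages at scales \<open>reg_dist \<phi> \<Omega> x\<close> and 0, the
  latter being the distance itself. Consequently the averaging radius, half of
  \<open>\<bar>reg_dist \<phi> \<Omega> x\<bar>\<close>, is at most the distance to the
  frontier.\<close>

lemma reg_dist_infdist:
  "\<bar>reg_dist \<phi> \<Omega> x - infdist x (frontier \<Omega>)\<bar> \<le> \<bar>reg_dist \<phi> \<Omega> x\<bar> / 2"
proof -
  have "dist_avg \<phi> \<Omega> x 0 = infdist x (frontier \<Omega>)"
    by (simp add: dist_avg_eq mollifier_integral)
  then show ?thesis
    using dist_avg_lipschitz[of \<Omega> x "reg_dist \<phi> \<Omega> x" 0] reg_dist_fixpoint[of \<Omega> x] by simp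
qed

end

context graph_domain
begin

text \<open>Replacing the distance by its tangent approximation inside the average costs only
  \<open>height x powr (1 + \<alpha>)\<close>, and the average of an affine function against a radial mollifier is its
  value at the centre.\<close>

lemma reg_dist_approx:
  assumes \<phi>: "radial_mollifier \<phi>" and x: "norm x \<le> 1 / 20" "0 < height x"
    and small: "25 * height x powr \<alpha> \<le> 1"
  shows "\<bar>reg_dist \<phi> \<Omega> x - height x / slope x\<bar> \<le> 75 * height x powr (1 + \<alpha>)"
proof -
  let ?u = "height x" and ?n = "slope x" and ?d = "\<lambda>y. infdist y (frontier \<Omega>)"
  define t where "t = reg_dist \<phi> \<Omega> x"
  \<comment> \<open>Error of the tangent approximation. Being at most \<open>?u\<close>, it keeps
    the averaging ball within radius \<open>2 * ?u\<close> of \<open>x\<close>.\<close>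
  define \<delta> where "\<delta> = 25 * ?u powr (1 + \<alpha>)"
  have n: "1 \<le> ?n" "?n \<le> 2" using slope_bounds[of x] x by auto
  have \<delta>: "0 \<le> \<delta>" "\<delta> \<le> ?u"
    using small x by (auto simp: \<delta>_def powr_Suc_exponent mult_left_le)
  have un: "?u / ?n \<le> ?u" using n x by (simp add: divide_simps)
  have "?d x \<le> ?u / ?n + \<delta>" using infdist_tangent_bounds(1)[OF x, of x] x by (simp add: \<delta>_def)
  moreover have "\<bar>t - ?d x\<bar> \<le> \<bar>t\<bar> / 2" unfolding t_def by (rule reg_dist_infdist[OF \<phi>])
  ultimately have t: "\<bar>t\<bar> / 2 \<le> ?u / ?n + \<delta>"
    using infdist_nonneg[of x "frontier \<Omega>"] by linarith
  have "\<bar>(LINT z|lborel. ?d (x - (t / 2) *\<^sub>R z) * \<phi> z) -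
      (LINT z|lborel. tangent x (x - (t / 2) *\<^sub>R z) / ?n * \<phi> z)\<bar> \<le> 3 * \<delta>"
  proof (rule mollifier_integral_diff_le[OF \<phi>])
    fix z :: 'a assume z: "z \<in> ball 0 1"
    define y where "y = x - (t / 2) *\<^sub>R z"
    have "norm (y - x) = \<bar>t\<bar> / 2 * norm z" by (simp add: y_def)
    also have "\<dots> \<le> \<bar>t\<bar> / 2" using z by (simp add: mult_left_le)
    finally have yx: "norm (y - x) \<le> ?u / ?n + \<delta>" using t by linarith
    then have "norm (y - x) \<le> 2 * ?u" using un \<delta> by linarith
    note b = infdist_tangent_bounds[OF x this]
    \<comment> \<open>The averaging ball reaches below the tangent plane by at most \<delta>, so
      dropping the absolute value of the tangent costs at most \<open>2 * \<delta>\<close>. This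
      explains \<open>3 * \<delta>\<close>, and 75 = 3 * 25.\<close>
    have "?u - tangent x y \<le> ?n * norm (y - x)" using tangent_lipschitz[of x y x] by simp
    also have "\<dots> \<le> ?n * (?u / ?n + \<delta>)" using n yx by (intro mult_left_mono) auto
    also have "\<dots> = ?u + ?n * \<delta>" using n by (simp add: field_simps)
    finally have "- \<delta> \<le> tangent x y / ?n" using n by (simp add: field_simps)
    moreover have "\<bar>tangent x y\<bar> / ?n = \<bar>tangent x y / ?n\<bar>" using n by simp
    ultimately have "\<bar>?d y - tangent x y / ?n\<bar> \<le> 3 * \<delta>" using b unfolding \<delta>_def[symmetric] by linarith
    then show "\<bar>?d (x - (t / 2) *\<^sub>R z) - tangent x (x - (t / 2) *\<^sub>R z) / ?n\<bar> \<le> 3 * \<delta>"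
      by (simp add: y_def)
  next
    show "continuous_on UNIV (\<lambda>z. tangent x (x - (t / 2) *\<^sub>R z) / ?n)"
      unfolding tangent_def divide_inverse by (intro continuous_intros)
  qed (auto intro!: continuous_intros)
  moreover have "(LINT z|lborel. ?d (x - (t / 2) *\<^sub>R z) * \<phi> z) = t"
    using reg_dist_fixpoint[OF \<phi>, of \<Omega> x] by (simp add: dist_avg_eq[OF \<phi>] t_def)
  moreover have "(LINT z|lborel. tangent x (x - (t / 2) *\<^sub>R z) / ?n * \<phi> z) = ?u / ?n"
  proof -
    let ?b = "- (t / (2 * ?n)) *\<^sub>R nrm x"
    have "tangent x (x - (t / 2) *\<^sub>R z) / ?n = ?u / ?n + ?b \<bullet> z" for z
      using n by (simp add: tangent_def diff_divide_distrib)
    then have "(\<lambda>z. tangent x (x - (t / 2) *\<^sub>R z) / ?n * \<phi> z) = (\<lambda>z. ?u / ?n * \<phi> z + (?b \<bullet> z) * \<phi> z)"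
      by (simp only: distrib_right)
    moreover have "integrable lborel (\<lambda>z. ?u / ?n * \<phi> z)" "integrable lborel (\<lambda>z. (?b \<bullet> z) * \<phi> z)"
      by (intro mollifier_integrable[OF \<phi>] continuous_intros)+
    ultimately show ?thesis
      using mollifier_integral_inner[OF \<phi>, of ?b] mollifier_integral[OF \<phi>]
      by (simp only: Bochner_Integration.integral_add integral_mult_right_zero)
  qed
  ultimately show ?thesis unfolding t_def[symmetric] \<delta>_def by linarith
qed

end

section \<open>One-dimensional barriers\<close>

text \<open>\<open>exp \<circ> \<Lambda>\<close> is the barrier, \<open>s\<close> its logarithmic slope with derivative \<open>s'\<close>, and \<open>c\<close> the sign of \<open>s\<close>;
  the second derivative of the barrier is \<open>(s\<^sup>2 - s + t * s') / t\<^sup>2\<close> times the barrier.\<close>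

definition barrier :: "real \<Rightarrow> real \<Rightarrow> real \<Rightarrow> real \<Rightarrow> real \<Rightarrow> (real \<Rightarrow> real) \<Rightarrow> (real \<Rightarrow> real) \<Rightarrow> (real \<Rightarrow> real) \<Rightarrow> bool"
  where "barrier \<kappa> \<alpha> C t\<^sub>1 c \<Lambda> s s' \<longleftrightarrow>
    (\<forall>t. 0 < t \<and> t < t\<^sub>1 \<longrightarrow>
       (\<Lambda> has_real_derivative s t / t) (at t) \<and> (s has_real_derivative s' t) (at t) \<and>
       isCont s' t \<and> 0 < c * s t \<and>
       (s t)\<^sup>2 - s t + t * s' t +
         C * t powr \<alpha> * (\<bar>(s t)\<^sup>2 - s t + t * s' t\<bar> + \<bar>s t\<bar> + \<bar>\<kappa>\<bar>) < \<kappa>)"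

text \<open>The barrier is \<open>t powr \<theta>\<close> times
  \<open>exp (\<sigma> / \<epsilon> * t powr \<epsilon>)\<close>. The second factor is bounded above
  and below near 0, so \<theta> alone fixes the growth, while \<sigma> produces the strict
  inequality.\<close>

lemma barrier_sum_powr:
  assumes "0 < \<epsilon>"
    and sgn: "\<And>t. 0 < t \<Longrightarrow> t < t\<^sub>1 \<Longrightarrow> 0 < c * (\<theta> + \<sigma> * t powr \<epsilon>)"
    and ineq: "\<And>t P. 0 < t \<Longrightarrow> t < t\<^sub>1 \<Longrightarrow>
      P = (\<theta> + \<sigma> * t powr \<epsilon>)\<^sup>2 - (\<theta> + \<sigma> * t powr \<epsilon>) + \<sigma> * \<epsilon> * t powr \<epsilon> \<Longrightarrow>
      P + C * t powr \<alpha> * (\<bar>P\<bar> + \<bar>\<theta> + \<sigma> * t powr \<epsilon>\<bar> + \<bar>\<kappa>\<bar>) < \<kappa>"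
  shows "barrier \<kappa> \<alpha> C t\<^sub>1 c (\<lambda>t. \<theta> * ln t + \<sigma> / \<epsilon> * t powr \<epsilon>)
    (\<lambda>t. \<theta> + \<sigma> * t powr \<epsilon>) (\<lambda>t. \<sigma> * \<epsilon> * t powr \<epsilon> / t)"
  unfolding barrier_def
proof (intro allI impI conjI)
  fix t assume t: "0 < t \<and> t < t\<^sub>1"
  show "((\<lambda>t. \<theta> * ln t + \<sigma> / \<epsilon> * t powr \<epsilon>) has_real_derivative (\<theta> + \<sigma> * t powr \<epsilon>) / t) (at t)"
    using t \<open>0 < \<epsilon>\<close> by (auto intro!: derivative_eq_intros simp: field_simps powr_diff)
  show "((\<lambda>t. \<theta> + \<sigma> * t powr \<epsilon>) has_real_derivative \<sigma> * \<epsilon> * t powr \<epsilon> / t) (at t)"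
    using t by (auto intro!: derivative_eq_intros simp: powr_diff)
  show "isCont (\<lambda>t. \<sigma> * \<epsilon> * t powr \<epsilon> / t) t"
    using t by (intro continuous_intros) auto
  show "0 < c * (\<theta> + \<sigma> * t powr \<epsilon>)" using sgn t by blast
  show "(\<theta> + \<sigma> * t powr \<epsilon>)\<^sup>2 - (\<theta> + \<sigma> * t powr \<epsilon>) + t * (\<sigma> * \<epsilon> * t powr \<epsilon> / t) +
      C * t powr \<alpha> * (\<bar>(\<theta> + \<sigma> * t powr \<epsilon>)\<^sup>2 - (\<theta> + \<sigma> * t powr \<epsilon>) + t * (\<sigma> * \<epsilon> * t powr \<epsilon> / t)\<bar> +
      \<bar>\<theta> + \<sigma> * t powr \<epsilon>\<bar> + \<bar>\<kappa>\<bar>) < \<kappa>"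
    by (rule ineq) (use t in auto)
qed

text \<open>Lets a boundary condition stated with the regularized distance be compared with a
  barrier evaluated at a paraboloid. The absolute value covers both signs of \<theta>.\<close>

lemma powr_comparison:
  fixes t d \<theta> :: real
  assumes "0 < t" "t / 2 \<le> d" "d \<le> 2 * t"
  shows "2 powr - \<bar>\<theta>\<bar> * d powr \<theta> \<le> t powr \<theta>"
proof -
  have "d powr \<theta> \<le> 2 powr \<bar>\<theta>\<bar> * t powr \<theta>"
  proof (cases "0 \<le> \<theta>")
    case True
    have "d powr \<theta> \<le> (2 * t) powr \<theta>" using assms True by (intro powr_mono2) auto
    then show ?thesis using assms True by (simp add: powr_mult)
  next
    case False
    have "d powr \<theta> \<le> (t / 2) powr \<theta>" using assms False by (intro powr_mono2') auto
    also have "\<dots> = 2 powr \<bar>\<theta>\<bar> * t powr \<theta>"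
      using assms False by (simp add: powr_divide powr_minus_divide)
    finally show ?thesis .
  qed
  then show ?thesis by (simp add: powr_minus_divide pos_divide_le_eq mult.commute)
qed

text \<open>In the logarithmic slope \<open>s = \<theta> + \<sigma> * t powr \<epsilon>\<close> the first-order effect of \<open>\<sigma>\<close> on
  \<open>s\<^sup>2 - s + t * s'\<close> is \<open>(\<epsilon> - sqrt (1 + 4 * \<kappa>)) * \<sigma> * t powr \<epsilon>\<close>, so \<open>\<sigma>\<close> is positive away from
  \<open>\<kappa> = - 1 / 4\<close> and negative close to it. For positive \<open>\<kappa>\<close>, \<open>\<sigma>\<close> is proportional to \<open>\<theta>\<close>, so that
  \<open>s\<close> keeps its sign on an interval that does not depend on \<open>\<kappa>\<close>.\<close>

lemma barrier_exists:
  fixes \<alpha> C :: real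
  assumes \<alpha>: "0 < \<alpha>" "\<alpha> < 1" and C: "0 \<le> C"
  shows "\<exists>t\<^sub>1>0. \<forall>\<kappa>\<ge>- 1 / 4. \<exists>c \<Lambda> s s' B c\<^sub>0. \<bar>c\<bar> = 1 \<and> barrier \<kappa> \<alpha> C t\<^sub>1 c \<Lambda> s s' \<and> 0 < c\<^sub>0 \<and>
      (\<forall>t d. 0 < t \<and> t < t\<^sub>1 \<and> t / 2 \<le> d \<and> d \<le> 2 * t \<longrightarrow> 0 < B d \<and> c\<^sub>0 * B d \<le> exp (\<Lambda> t)) \<and>
      (- 1 / 4 < \<kappa> \<and> B = (\<lambda>d. d powr theta_minus \<kappa>) \<or>
       \<kappa> = - 1 / 4 \<and> B = (\<lambda>d. d powr (1 / 2) * \<bar>ln d\<bar>))"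
proof -
  \<comment> \<open>On the interval up to \<open>t\<^sub>1\<close>, powers with exponent at least
    \<alpha> / 8 will be at most \<delta>. Its size is dictated by the weakest margin below,
    \<open>\<tau> * \<alpha>\<^sup>2 / 64\<close>, against an error of
    \<open>3 * (\<tau> * \<alpha>\<^sup>2 / 256)\<close>.\<close>
  define \<delta> where "\<delta> = \<alpha>\<^sup>2 / (256 * (C + 1))"
  \<comment> \<open>The second bound serves the logarithmic case, where it gives
    \<open>\<bar>1 / ln t\<bar> \<le> \<alpha> / 16\<close>.\<close>
  define t\<^sub>1 where "t\<^sub>1 = min (\<delta> powr (8 / \<alpha>)) (exp (- 16 / \<alpha>))"
  have \<alpha>2: "0 < \<alpha>\<^sup>2" "\<alpha>\<^sup>2 \<le> \<alpha>" using \<alpha> by (auto simp: power2_eq_square mult_left_le)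
  have "0 < \<delta>" using \<alpha>2 C by (simp add: \<delta>_def)
  have "\<delta> \<le> \<alpha>\<^sup>2 / 256" unfolding \<delta>_def using \<alpha>2 C by (intro divide_left_mono) auto
  then have \<delta>: "\<delta> \<le> \<alpha> / 256" "\<delta> \<le> 1" using \<alpha> \<alpha>2 by auto
  have "C * \<delta> = \<alpha>\<^sup>2 / 256 * (C / (C + 1))" by (simp add: \<delta>_def)
  also have "\<dots> \<le> \<alpha>\<^sup>2 / 256" using C by (intro mult_left_le) auto
  finally have C\<delta>: "C * \<delta> \<le> \<alpha>\<^sup>2 / 256" .
  have t1_pos: "0 < t\<^sub>1" using \<open>0 < \<delta>\<close> by (simp add: t\<^sub>1_def)
  have t1_le: "t\<^sub>1 \<le> 1" using \<alpha> by (simp add: t\<^sub>1_def min_le_iff_disj)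
  \<comment> \<open>Splitting \<open>t powr \<alpha>\<close> as
    \<open>t powr \<epsilon> * t powr (\<alpha> - \<epsilon>)\<close> turns the error factor into a
    small multiple of the margin's own power.\<close>
  have small: "0 < t powr \<epsilon> \<and> t powr \<epsilon> \<le> \<alpha> / 256 \<and> 0 \<le> C * t powr \<alpha> \<and> C * t powr \<alpha> \<le> t powr \<epsilon> * (\<alpha>\<^sup>2 / 256)"
    if t: "0 < t" "t < t\<^sub>1" and \<epsilon>: "\<alpha> / 8 \<le> \<epsilon>" "\<epsilon> \<le> \<alpha> / 2" for t \<epsilon>
  proof -
    have le: "t powr \<eta> \<le> \<delta>" if "\<alpha> / 8 \<le> \<eta>" for \<eta>
    proof -
      have "t powr \<eta> \<le> t powr (\<alpha> / 8)" using t t1_le that by (intro powr_mono') auto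
      also have "\<dots> \<le> (\<delta> powr (8 / \<alpha>)) powr (\<alpha> / 8)"
        using t \<alpha> by (intro powr_mono2) (auto simp: t\<^sub>1_def)
      also have "\<dots> = \<delta>" using \<alpha> \<open>0 < \<delta>\<close> by (simp add: powr_powr)
      finally show ?thesis .
    qed
    have "C * t powr \<alpha> = t powr \<epsilon> * (C * t powr (\<alpha> - \<epsilon>))"
      using t by (simp add: powr_add[symmetric])
    also have "\<dots> \<le> t powr \<epsilon> * (C * \<delta>)"
      using C le[of "\<alpha> - \<epsilon>"] \<epsilon> \<alpha> by (intro mult_left_mono) auto
    also have "\<dots> \<le> t powr \<epsilon> * (\<alpha>\<^sup>2 / 256)" using C\<delta> by (intro mult_left_mono) auto
    finally show ?thesis using le[OF \<epsilon>(1)] \<delta> t C by auto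
  qed
  have "\<exists>c \<Lambda> s s' B c\<^sub>0. \<bar>c\<bar> = 1 \<and> barrier \<kappa> \<alpha> C t\<^sub>1 c \<Lambda> s s' \<and> 0 < c\<^sub>0 \<and>
      (\<forall>t d. 0 < t \<and> t < t\<^sub>1 \<and> t / 2 \<le> d \<and> d \<le> 2 * t \<longrightarrow> 0 < B d \<and> c\<^sub>0 * B d \<le> exp (\<Lambda> t)) \<and>
      (- 1 / 4 < \<kappa> \<and> B = (\<lambda>d. d powr theta_minus \<kappa>) \<or>
       \<kappa> = - 1 / 4 \<and> B = (\<lambda>d. d powr (1 / 2) * \<bar>ln d\<bar>))"
    if \<kappa>: "- 1 / 4 \<le> \<kappa>" for \<kappa>
  proof -
    define \<mu> where "\<mu> = sqrt (1 + 4 * \<kappa>)"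
    define \<theta> where "\<theta> = theta_minus \<kappa>"
    have \<mu>0: "0 \<le> \<mu>" and \<mu>\<kappa>: "\<mu>\<^sup>2 = 1 + 4 * \<kappa>" using \<kappa> by (auto simp: \<mu>_def)
    have \<theta>\<mu>: "\<theta> = 1 / 2 - \<mu> / 2"
      by (simp add: \<theta>_def \<mu>_def theta_minus_def diff_divide_distrib)
    have \<mu>\<theta>: "\<mu> = 1 - 2 * \<theta>" using \<theta>\<mu> by simp
    have \<theta>\<kappa>: "\<theta>\<^sup>2 - \<theta> = \<kappa>" 
      using \<mu>\<kappa> unfolding \<mu>\<theta> by (simp add: power2_eq_square algebra_simps)
    have expand: "(\<theta> + \<sigma> * \<tau>)\<^sup>2 - (\<theta> + \<sigma> * \<tau>) + \<sigma> * \<epsilon> * \<tau> = \<kappa> - \<sigma> * \<tau> * (\<mu> - \<epsilon> - \<sigma> * \<tau>)" for \<sigma> \<tau> \<epsilon>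
      unfolding \<theta>\<kappa>[symmetric] \<mu>\<theta> by (simp add: power2_eq_square algebra_simps)
    have finish: ?thesis if gt: "- 1 / 4 < \<kappa>" and "\<bar>c\<bar> = 1" "0 < \<epsilon>" and
        bar: "barrier \<kappa> \<alpha> C t\<^sub>1 c (\<lambda>t. \<theta> * ln t + \<sigma> / \<epsilon> * t powr \<epsilon>) s s'" for c \<sigma> \<epsilon> s s'
    proof -
      define c\<^sub>0 where "c\<^sub>0 = 2 powr - \<bar>\<theta>\<bar> * exp (- \<bar>\<sigma>\<bar> / \<epsilon>)"
      have "0 < d powr \<theta> \<and> c\<^sub>0 * d powr \<theta> \<le> exp (\<theta> * ln t + \<sigma> / \<epsilon> * t powr \<epsilon>)"
        if t: "0 < t" "t < t\<^sub>1" "t / 2 \<le> d" "d \<le> 2 * t" for t d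
      proof -
        have "t powr \<epsilon> \<le> 1" using t t1_le \<open>0 < \<epsilon>\<close> by (intro powr_le1) auto
        then have "\<bar>\<sigma>\<bar> * t powr \<epsilon> \<le> \<bar>\<sigma>\<bar> * 1" by (intro mult_left_mono) auto
        moreover have "- (\<bar>\<sigma>\<bar> * t powr \<epsilon>) \<le> \<sigma> * t powr \<epsilon>"
          using abs_ge_minus_self[of "\<sigma> * t powr \<epsilon>"] by (simp add: abs_mult)
        ultimately have "- \<bar>\<sigma>\<bar> / \<epsilon> \<le> \<sigma> / \<epsilon> * t powr \<epsilon>" using \<open>0 < \<epsilon>\<close> by (simp add: divide_simps)
        then have "(2 powr - \<bar>\<theta>\<bar> * d powr \<theta>) * exp (- \<bar>\<sigma>\<bar> / \<epsilon>) \<le> t powr \<theta> * exp (\<sigma> / \<epsilon> * t powr \<epsilon>)"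
          using powr_comparison[OF t(1,3,4), of \<theta>] by (intro mult_mono) auto
        also have "\<dots> = exp (\<theta> * ln t + \<sigma> / \<epsilon> * t powr \<epsilon>)"
          using t by (simp add: exp_add powr_def[of t \<theta>])
        finally have "2 powr - \<bar>\<theta>\<bar> * exp (- \<bar>\<sigma>\<bar> / \<epsilon>) * d powr \<theta> \<le> exp (\<theta> * ln t + \<sigma> / \<epsilon> * t powr \<epsilon>)"
          by (simp only: mult_ac)
        then show ?thesis using t by (simp add: c\<^sub>0_def)
      qed
      moreover have "0 < c\<^sub>0" by (simp add: c\<^sub>0_def)
      ultimately show ?thesis using bar gt \<open>\<bar>c\<bar> = 1\<close> unfolding \<theta>_def[symmetric]
        by (intro exI[of _ c] exI[of _ "\<lambda>t. \<theta> * ln t + \<sigma> / \<epsilon> * t powr \<epsilon>"] exI[of _ s] exI[of _ s']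
            exI[of _ "\<lambda>d. d powr \<theta>"] exI[of _ c\<^sub>0] conjI) auto
    qed
    \<comment> \<open>In the first regime \<mu> > 1 and the barrier decreases. In the second,
      \<epsilon> = \<alpha> / 8 stays below the gap \<mu>; in the third, \<epsilon> = \<alpha> / 2
      exceeds it; in the last the root is double and a logarithm appears.\<close>
    consider "0 < \<kappa>" | "\<kappa> \<le> 0" "\<alpha> / 4 \<le> \<mu>" | "- 1 / 4 < \<kappa>" "\<mu> < \<alpha> / 4" | "\<kappa> = - 1 / 4"
      using \<kappa> by linarith
    then show ?thesis
    proof cases
      case 1
      define p where "p = - \<theta>"
      have "1\<^sup>2 < \<mu>\<^sup>2" using 1 \<mu>\<kappa> by simp
      then have "1 < \<mu>" using \<mu>0 power2_less_imp_less by blast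
      then have p: "0 < p" "\<theta> = - p" "p\<^sup>2 + p = \<kappa>" "\<mu> = 1 + 2 * p"
        using \<mu>\<theta> \<theta>\<kappa> unfolding p_def by simp_all
      have "barrier \<kappa> \<alpha> C t\<^sub>1 (- 1) (\<lambda>t. \<theta> * ln t + p / (\<alpha> / 2) * t powr (\<alpha> / 2))
          (\<lambda>t. \<theta> + p * t powr (\<alpha> / 2)) (\<lambda>t. p * (\<alpha> / 2) * t powr (\<alpha> / 2) / t)"
      proof (rule barrier_sum_powr)
        fix t P assume t: "0 < t" "t < t\<^sub>1"
        define \<tau> where "\<tau> = t powr (\<alpha> / 2)"
        define T where "T = C * t powr \<alpha>"
        have s: "0 < \<tau>" "\<tau> \<le> \<alpha> / 256" "0 \<le> T" "T \<le> \<tau> * (\<alpha>\<^sup>2 / 256)"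
          using small[OF t, of "\<alpha> / 2"] \<alpha> by (auto simp: \<tau>_def T_def)
        have "p * \<tau> < p * 1" using p s \<alpha> by (intro mult_strict_left_mono) auto
        then show "0 < - 1 * (\<theta> + p * t powr (\<alpha> / 2))" using p by (simp add: \<tau>_def[symmetric])
        assume "P = (\<theta> + p * t powr (\<alpha> / 2))\<^sup>2 - (\<theta> + p * t powr (\<alpha> / 2)) + p * (\<alpha> / 2) * t powr (\<alpha> / 2)"
        then have P: "P = \<kappa> - p * \<tau> * (\<mu> - \<alpha> / 2 - p * \<tau>)" unfolding expand \<tau>_def by simp
        have "0 \<le> p * \<tau>" "p * \<tau> \<le> p * (1 / 256)" using p s \<alpha> by (auto intro!: mult_left_mono)
        then have "(1 / 2 + p / 2) \<le> \<mu> - \<alpha> / 2 - p * \<tau>" "\<mu> - \<alpha> / 2 - p * \<tau> \<le> 2 + 2 * p"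
          using p(1,4) \<alpha> by - linarith+
        then have "p * \<tau> * (1 / 2 + p / 2) \<le> p * \<tau> * (\<mu> - \<alpha> / 2 - p * \<tau>)"
            "p * \<tau> * (\<mu> - \<alpha> / 2 - p * \<tau>) \<le> p * \<tau> * (2 + 2 * p)"
          using p s by (intro mult_left_mono; simp)+
        \<comment> \<open>Through \<open>p\<^sup>2 + p = \<kappa>\<close>, margin and error both
          become multiples of \<open>\<kappa> * \<tau>\<close>, with factors 1/2 and 3/256. This
          makes the interval uniform for large \<kappa>.\<close>
        moreover have "p * \<tau> * (1 / 2 + p / 2) = \<kappa> * \<tau> / 2" "p * \<tau> * (2 + 2 * p) = 2 * (\<kappa> * \<tau>)"
          unfolding p(3)[symmetric] by (auto simp: power2_eq_square field_simps)
        ultimately have P1: "P \<le> \<kappa> - \<kappa> * \<tau> / 2" "\<kappa> - 2 * (\<kappa> * \<tau>) \<le> P" unfolding P by - linarith+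
        have \<kappa>\<tau>: "0 < \<kappa> * \<tau>" "\<kappa> * \<tau> \<le> \<kappa> * (1 / 256)" using 1 s \<alpha> by (auto intro!: mult_left_mono)
        have "\<bar>\<theta> + p * \<tau>\<bar> \<le> p" using \<open>p * \<tau> < p * 1\<close> p s by (auto simp: abs_if)
        also have "p \<le> \<kappa>" using p(3) by (metis zero_le_power2 le_add_same_cancel2)
        finally have "\<bar>P\<bar> + \<bar>\<theta> + p * \<tau>\<bar> + \<bar>\<kappa>\<bar> \<le> 3 * \<kappa>" using P1 \<kappa>\<tau> 1 by linarith
        then have "T * (\<bar>P\<bar> + \<bar>\<theta> + p * \<tau>\<bar> + \<bar>\<kappa>\<bar>) \<le> (\<tau> * (\<alpha>\<^sup>2 / 256)) * (3 * \<kappa>)"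
          using s by (intro mult_mono) auto
        also have "\<dots> = (\<kappa> * \<tau>) * (3 * \<alpha>\<^sup>2 / 256)" by simp
        also have "\<dots> \<le> (\<kappa> * \<tau>) * (3 / 256)" using \<alpha>2 \<alpha> \<kappa>\<tau> by (intro mult_left_mono) auto
        finally show "P + C * t powr \<alpha> * (\<bar>P\<bar> + \<bar>\<theta> + p * t powr (\<alpha> / 2)\<bar> + \<bar>\<kappa>\<bar>) < \<kappa>"
          unfolding \<tau>_def[symmetric] T_def[symmetric] using P1 \<kappa>\<tau> by linarith
      qed (use \<alpha> in simp)
      then show ?thesis using 1 \<alpha> by (intro finish[of "- 1" "\<alpha> / 2" p]) auto
    next
      case 2
      have "\<mu>\<^sup>2 \<le> 1\<^sup>2" using 2 \<mu>\<kappa> by simp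
      then have \<mu>1: "\<mu> \<le> 1" by (rule power2_le_imp_le) simp
      have "0 < \<mu>\<^sup>2" using 2 \<alpha> by (intro zero_less_power) linarith
      then have gt: "- 1 / 4 < \<kappa>" using \<mu>\<kappa> by linarith
      have \<theta>: "0 \<le> \<theta>" "\<theta> \<le> 1 / 2" using \<theta>\<mu> \<mu>0 \<mu>1 by auto
      have "barrier \<kappa> \<alpha> C t\<^sub>1 1 (\<lambda>t. \<theta> * ln t + \<mu> / (\<alpha> / 8) * t powr (\<alpha> / 8))
          (\<lambda>t. \<theta> + \<mu> * t powr (\<alpha> / 8)) (\<lambda>t. \<mu> * (\<alpha> / 8) * t powr (\<alpha> / 8) / t)"
      proof (rule barrier_sum_powr)
        fix t P assume t: "0 < t" "t < t\<^sub>1"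
        define \<tau> where "\<tau> = t powr (\<alpha> / 8)"
        define T where "T = C * t powr \<alpha>"
        have s: "0 < \<tau>" "\<tau> \<le> \<alpha> / 256" "0 \<le> T" "T \<le> \<tau> * (\<alpha>\<^sup>2 / 256)"
          using small[OF t, of "\<alpha> / 8"] \<alpha> by (auto simp: \<tau>_def T_def)
        have \<mu>\<tau>: "0 < \<mu> * \<tau>" "\<mu> * \<tau> \<le> \<mu> * (1 / 256)"
          using 2 s \<alpha> by (auto intro!: mult_pos_pos mult_left_mono)
        then show "0 < 1 * (\<theta> + \<mu> * t powr (\<alpha> / 8))" using \<theta> by (simp add: \<tau>_def[symmetric])
        assume "P = (\<theta> + \<mu> * t powr (\<alpha> / 8))\<^sup>2 - (\<theta> + \<mu> * t powr (\<alpha> / 8)) + \<mu> * (\<alpha> / 8) * t powr (\<alpha> / 8)"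
        then have P: "P = \<kappa> - \<mu> * \<tau> * (\<mu> - \<alpha> / 8 - \<mu> * \<tau>)" unfolding expand \<tau>_def by simp
        \<comment> \<open>Uses \<open>\<alpha> / 8 \<le> \<mu> / 2\<close>. The margin is then at
          least \<open>\<mu>\<^sup>2 * \<tau> / 4\<close>, hence at least
          \<open>\<alpha>\<^sup>2 * \<tau> / 64\<close>.\<close>
        have f: "\<mu> / 4 \<le> \<mu> - \<alpha> / 8 - \<mu> * \<tau>" "\<mu> - \<alpha> / 8 - \<mu> * \<tau> \<le> 1"
          using 2 \<mu>\<tau> \<mu>1 \<alpha> by - linarith+
        then have "\<mu> * \<tau> * (\<mu> / 4) \<le> \<mu> * \<tau> * (\<mu> - \<alpha> / 8 - \<mu> * \<tau>)"
            "\<mu> * \<tau> * (\<mu> - \<alpha> / 8 - \<mu> * \<tau>) \<le> \<mu> * \<tau> * 1"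
          using \<mu>\<tau> by (intro mult_left_mono; simp)+
        moreover have "(\<alpha> / 4)\<^sup>2 * \<tau> \<le> \<mu>\<^sup>2 * \<tau>"
          using 2 \<alpha> s by (intro mult_right_mono power_mono) auto
        moreover have "(\<alpha> / 4)\<^sup>2 * \<tau> = \<tau> * \<alpha>\<^sup>2 / 16" "\<mu> * \<tau> * (\<mu> / 4) = \<mu>\<^sup>2 * \<tau> / 4"
          by (simp_all add: power_divide power2_eq_square)
        ultimately have P1: "P \<le> \<kappa> - \<tau> * \<alpha>\<^sup>2 / 64" "\<kappa> - 1 / 256 \<le> P" unfolding P using \<mu>\<tau> \<mu>1 by - linarith+
        have a\<tau>: "0 < \<tau> * \<alpha>\<^sup>2" using s \<alpha>2 by simp
        have "\<bar>P\<bar> + \<bar>\<theta> + \<mu> * \<tau>\<bar> + \<bar>\<kappa>\<bar> \<le> 3" using P1 2 \<kappa> \<theta> \<mu>\<tau> \<mu>1 a\<tau> by linarith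
        then have "T * (\<bar>P\<bar> + \<bar>\<theta> + \<mu> * \<tau>\<bar> + \<bar>\<kappa>\<bar>) \<le> (\<tau> * (\<alpha>\<^sup>2 / 256)) * 3"
          using s by (intro mult_mono) auto
        then show "P + C * t powr \<alpha> * (\<bar>P\<bar> + \<bar>\<theta> + \<mu> * t powr (\<alpha> / 8)\<bar> + \<bar>\<kappa>\<bar>) < \<kappa>"
          unfolding \<tau>_def[symmetric] T_def[symmetric] using P1 a\<tau> by linarith
      qed (use \<alpha> in simp)
      then show ?thesis using gt \<alpha> by (intro finish[of 1 "\<alpha> / 8" \<mu>]) auto
    next
      case 3
      \<comment> \<open>Now \<mu> - \<epsilon> is negative, so \<sigma> = -1. The lower bound on
        \<theta> keeps the logarithmic slope positive after the subtraction.\<close>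
      have \<theta>: "1 / 4 \<le> \<theta>" "\<theta> \<le> 1 / 2" using 3 \<theta>\<mu> \<mu>0 \<alpha> by auto
      have "\<mu>\<^sup>2 \<le> 1\<^sup>2" using 3 \<mu>0 \<alpha> by (intro power_mono) auto
      then have \<kappa>0: "\<kappa> \<le> 0" using \<mu>\<kappa> by simp
      have "barrier \<kappa> \<alpha> C t\<^sub>1 1 (\<lambda>t. \<theta> * ln t + (- 1) / (\<alpha> / 2) * t powr (\<alpha> / 2))
          (\<lambda>t. \<theta> + (- 1) * t powr (\<alpha> / 2)) (\<lambda>t. (- 1) * (\<alpha> / 2) * t powr (\<alpha> / 2) / t)"
      proof (rule barrier_sum_powr)
        fix t P assume t: "0 < t" "t < t\<^sub>1"
        define \<tau> where "\<tau> = t powr (\<alpha> / 2)"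
        define T where "T = C * t powr \<alpha>"
        have s: "0 < \<tau>" "\<tau> \<le> \<alpha> / 256" "0 \<le> T" "T \<le> \<tau> * (\<alpha>\<^sup>2 / 256)"
          using small[OF t, of "\<alpha> / 2"] \<alpha> by (auto simp: \<tau>_def T_def)
        then show "0 < 1 * (\<theta> + (- 1) * t powr (\<alpha> / 2))"
          using \<theta> \<alpha> unfolding \<tau>_def[symmetric] by simp
        assume "P = (\<theta> + (- 1) * t powr (\<alpha> / 2))\<^sup>2 - (\<theta> + (- 1) * t powr (\<alpha> / 2)) + (- 1) * (\<alpha> / 2) * t powr (\<alpha> / 2)"
        then have P: "P = \<kappa> - \<tau> * (\<alpha> / 2 - \<mu> - \<tau>)"
          unfolding expand \<tau>_def[symmetric] by (simp add: algebra_simps)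
        have "\<alpha> / 8 \<le> \<alpha> / 2 - \<mu> - \<tau>" "\<alpha> / 2 - \<mu> - \<tau> \<le> 1" using 3 s \<mu>0 \<alpha> by auto
        then have "\<tau> * (\<alpha> / 8) \<le> \<tau> * (\<alpha> / 2 - \<mu> - \<tau>)" "\<tau> * (\<alpha> / 2 - \<mu> - \<tau>) \<le> \<tau> * 1"
          using s by (intro mult_left_mono; simp)+
        then have P1: "P \<le> \<kappa> - \<tau> * (\<alpha> / 8)" "\<kappa> - \<tau> \<le> P" unfolding P by - linarith+
        have a\<tau>: "0 < \<tau> * \<alpha>" "\<tau> * \<alpha>\<^sup>2 \<le> \<tau> * \<alpha>" using s \<alpha> \<alpha>2 by (auto intro!: mult_left_mono)
        have "\<bar>P\<bar> + \<bar>\<theta> + (- 1) * \<tau>\<bar> + \<bar>\<kappa>\<bar> \<le> 3" using P1 \<kappa>0 \<kappa> \<theta> s \<alpha> a\<tau> by linarith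
        then have "T * (\<bar>P\<bar> + \<bar>\<theta> + (- 1) * \<tau>\<bar> + \<bar>\<kappa>\<bar>) \<le> (\<tau> * (\<alpha>\<^sup>2 / 256)) * 3"
          using s by (intro mult_mono) auto
        then have "T * (\<bar>P\<bar> + \<bar>\<theta> + (- 1) * \<tau>\<bar> + \<bar>\<kappa>\<bar>) \<le> \<tau> * \<alpha> * 3 / 256" using a\<tau> by linarith
        then show "P + C * t powr \<alpha> * (\<bar>P\<bar> + \<bar>\<theta> + (- 1) * t powr (\<alpha> / 2)\<bar> + \<bar>\<kappa>\<bar>) < \<kappa>"
          unfolding \<tau>_def[symmetric] T_def[symmetric] using P1 a\<tau> by linarith
      qed (use \<alpha> in simp)
      then show ?thesis using 3 \<alpha> by (intro finish[of 1 "\<alpha> / 2" "- 1"]) auto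
    next
      case 4
      define \<epsilon> where "\<epsilon> = \<alpha> / 2"
      \<comment> \<open>\<open>exp \<circ> \<Lambda>\<close> is \<open>sqrt t * (- ln t)\<close>
        times \<open>exp (- (t powr \<epsilon> / \<epsilon>))\<close>. The first part solves F'' =
        -F / (4 t^2) exactly; the exponential supplies the margin.\<close>
      define \<Lambda> where "\<Lambda> = (\<lambda>t. ln t / 2 + ln (- ln t) - t powr \<epsilon> / \<epsilon>)"
      define s where "s = (\<lambda>t. 1 / 2 + 1 / ln t - t powr \<epsilon>)"
      define s' where "s' = (\<lambda>t. (- 1 / (ln t)\<^sup>2 - \<epsilon> * t powr \<epsilon>) / t)"
      have \<epsilon>: "0 < \<epsilon>" using \<alpha> by (simp add: \<epsilon>_def)
      have ln: "ln t < - 16 / \<alpha>" "ln t < - 16" if t: "0 < t" "t < t\<^sub>1" for t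
      proof -
        have "t < exp (- 16 / \<alpha>)" using t by (simp add: t\<^sub>1_def)
        then show 1: "ln t < - 16 / \<alpha>" using t ln_less_cancel_iff[of t "exp (- 16 / \<alpha>)"] by simp
        have "16 < 16 / \<alpha>" using \<alpha> by (simp add: divide_simps)
        then show "ln t < - 16" using 1 by simp
      qed
      have "barrier \<kappa> \<alpha> C t\<^sub>1 1 \<Lambda> s s'"
        unfolding barrier_def
      proof (intro allI impI conjI)
        fix t assume "0 < t \<and> t < t\<^sub>1"
        then have t: "0 < t" "t < t\<^sub>1" by auto
        note l = ln[OF t]
        have "t < 1" using t t1_le by simp
        show "(\<Lambda> has_real_derivative s t / t) (at t)"
          unfolding \<Lambda>_def s_def using t l \<epsilon> \<open>t < 1\<close>
          by (auto intro!: derivative_eq_intros simp: field_simps powr_diff)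
        show "(s has_real_derivative s' t) (at t)"
          unfolding s'_def s_def using t l \<open>t < 1\<close>
          by (auto intro!: derivative_eq_intros simp: field_simps power2_eq_square powr_diff)
        show "isCont s' t"
          unfolding s'_def using t l by (intro continuous_intros) auto
        define \<tau> where "\<tau> = t powr \<epsilon>"
        define T where "T = C * t powr \<alpha>"
        define i where "i = 1 / ln t"
        have sm: "0 < \<tau>" "\<tau> \<le> \<alpha> / 256" "0 \<le> T" "T \<le> \<tau> * (\<alpha>\<^sup>2 / 256)"
          using small[OF t, of "\<alpha> / 2"] \<alpha> by (auto simp: \<tau>_def T_def \<epsilon>_def)
        have i: "- \<alpha> / 16 \<le> i" "i \<le> 0" using l \<alpha> by (auto simp: i_def divide_simps mult.commute)
        have st: "s t = 1 / 2 + i - \<tau>" by (simp add: s_def i_def \<tau>_def)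
        show "0 < 1 * s t" using st i sm \<alpha> by simp
        define P where "P = (s t)\<^sup>2 - s t + t * s' t"
        have "t * s' t = - i\<^sup>2 - \<epsilon> * \<tau>" using t by (simp add: s'_def i_def \<tau>_def power_divide)
        \<comment> \<open>The squares of \<open>i\<close> cancel; what remains of the logarithm is
          the cross term \<open>2 * i * \<tau>\<close>, at most \<open>\<alpha> * \<tau> / 8\<close>
          in size.\<close>
        then have P: "P = \<kappa> - \<tau> * (\<alpha> / 2 + 2 * i - \<tau>)"
          unfolding P_def st 4 by (simp add: power2_eq_square \<epsilon>_def algebra_simps)
        have "\<alpha> / 8 \<le> \<alpha> / 2 + 2 * i - \<tau>" "\<alpha> / 2 + 2 * i - \<tau> \<le> 1" using i sm \<alpha> by auto
        then have "\<tau> * (\<alpha> / 8) \<le> \<tau> * (\<alpha> / 2 + 2 * i - \<tau>)" "\<tau> * (\<alpha> / 2 + 2 * i - \<tau>) \<le> \<tau> * 1"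
          using sm by (intro mult_left_mono; simp)+
        then have P1: "P \<le> \<kappa> - \<tau> * (\<alpha> / 8)" "\<kappa> - \<tau> \<le> P" unfolding P by - linarith+
        have a\<tau>: "0 < \<tau> * \<alpha>" "\<tau> * \<alpha>\<^sup>2 \<le> \<tau> * \<alpha>" using sm \<alpha> \<alpha>2 by (auto intro!: mult_left_mono)
        have "\<bar>P\<bar> + \<bar>s t\<bar> + \<bar>\<kappa>\<bar> \<le> 3" using P1 4 st i sm \<alpha> a\<tau> by linarith
        then have "T * (\<bar>P\<bar> + \<bar>s t\<bar> + \<bar>\<kappa>\<bar>) \<le> (\<tau> * (\<alpha>\<^sup>2 / 256)) * 3"
          using sm by (intro mult_mono) auto
        then have "T * (\<bar>P\<bar> + \<bar>s t\<bar> + \<bar>\<kappa>\<bar>) \<le> \<tau> * \<alpha> * 3 / 256" using a\<tau> by linarith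
        then show "(s t)\<^sup>2 - s t + t * s' t +
            C * t powr \<alpha> * (\<bar>(s t)\<^sup>2 - s t + t * s' t\<bar> + \<bar>s t\<bar> + \<bar>\<kappa>\<bar>) < \<kappa>"
          unfolding T_def[symmetric] P_def[symmetric] using P1 a\<tau> by linarith
      qed
      \<comment> \<open>Three losses: the comparison of powers,
        \<open>\<bar>ln d\<bar> \<le> 2 * (- ln t)\<close>, and the lower bound of the exponential
        factor for \<open>t \<le> 1\<close>.\<close>
      moreover define c\<^sub>0 where "c\<^sub>0 = 2 powr - (1 / 2) * (1 / 2) * exp (- 1 / \<epsilon>)"
      have "0 < d powr (1 / 2) * \<bar>ln d\<bar> \<and> c\<^sub>0 * (d powr (1 / 2) * \<bar>ln d\<bar>) \<le> exp (\<Lambda> t)"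
        if t: "0 < t" "t < t\<^sub>1" "t / 2 \<le> d" "d \<le> 2 * t" for t d
      proof -
        note l = ln[OF t(1,2)]
        have "0 < d" using t by simp
        have "ln d \<le> ln (2 * t)" "ln t \<le> ln (2 * d)" using t by auto
        then have "ln d \<le> ln 2 + ln t" "ln t \<le> ln 2 + ln d" using t \<open>0 < d\<close> by (auto simp: ln_mult)
        moreover have "ln 2 < (1 :: real)" using ln_2_less_1 .
        ultimately have d: "0 < \<bar>ln d\<bar>" "1 / 2 * \<bar>ln d\<bar> \<le> - ln t" using l by auto
        have "t powr \<epsilon> \<le> 1" using t t1_le \<epsilon> by (intro powr_le1) auto
        then have "- 1 / \<epsilon> \<le> - (t powr \<epsilon> / \<epsilon>)" using \<epsilon> by (simp add: divide_simps)
        then have "((2 powr - \<bar>1 / 2\<bar> * d powr (1 / 2)) * (1 / 2 * \<bar>ln d\<bar>)) * exp (- 1 / \<epsilon>)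
            \<le> (t powr (1 / 2) * (- ln t)) * exp (- (t powr \<epsilon> / \<epsilon>))"
          using powr_comparison[OF t(1,3,4), of "1 / 2"] d l by (intro mult_mono) (auto simp: mult_nonneg_nonpos)
        also have "\<dots> = exp (\<Lambda> t)"
        proof -
          have "exp (\<Lambda> t) = exp (ln t / 2) * exp (ln (- ln t)) * exp (- (t powr \<epsilon> / \<epsilon>))"
            unfolding \<Lambda>_def by (simp add: exp_add[symmetric])
          moreover have "exp (ln (- ln t)) = - ln t" using l by (intro exp_ln) linarith
          ultimately show ?thesis using t by (simp add: powr_def[of t "1 / 2"])
        qed
        finally have "2 powr - \<bar>1 / 2\<bar> * (1 / 2) * exp (- 1 / \<epsilon>) * (d powr (1 / 2) * \<bar>ln d\<bar>) \<le> exp (\<Lambda> t)"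
          by (simp only: mult_ac)
        then show ?thesis using d \<open>0 < d\<close> by (simp add: c\<^sub>0_def)
      qed
      moreover have "0 < c\<^sub>0" by (simp add: c\<^sub>0_def)
      ultimately show ?thesis using 4
        by (intro exI[of _ 1] exI[of _ \<Lambda>] exI[of _ s] exI[of _ s']
            exI[of _ "\<lambda>d. d powr (1 / 2) * \<bar>ln d\<bar>"] exI[of _ c\<^sub>0] conjI) auto
    qed
  qed
  note main = this
  show ?thesis by (rule exI[of _ t\<^sub>1], rule conjI[OF t1_pos], intro allI impI, rule main)
qed

section \<open>Quadratic test functions\<close>

text \<open>\<open>Ck_on\<close> and \<open>laplacian\<close> iterate
  \<open>frechet_derivative\<close>, whose first application is given by \<open>D\<close> on
  \<open>N\<close> only; openness of \<open>N\<close> allows it to be differentiated there through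
  \<open>D\<close>.\<close>

lemma Ck_on_2_laplacian:
  fixes f :: "'a::euclidean_space \<Rightarrow> real"
  assumes N: "open N"
    and D: "\<And>x. x \<in> N \<Longrightarrow> (f has_derivative (\<lambda>h. D x \<bullet> h)) (at x)"
    and H: "\<And>x b. x \<in> N \<Longrightarrow> b \<in> Basis \<Longrightarrow> ((\<lambda>y. D y \<bullet> b) has_derivative H b x) (at x)"
    and cont: "\<And>b b'. b \<in> Basis \<Longrightarrow> b' \<in> Basis \<Longrightarrow> continuous_on N (\<lambda>x. H b x b')"
  shows "Ck_on 2 f N" and "x \<in> N \<Longrightarrow> laplacian f x = (\<Sum>b\<in>Basis. H b x b)"
proof -
  have first: "partial_deriv b f y = D y \<bullet> b" if "y \<in> N" for y b
    using frechet_derivative_at[OF D[OF that]] by metis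
  have second_deriv: "(partial_deriv b f has_derivative H b y) (at y)" if "y \<in> N" "b \<in> Basis" for y b
    by (rule has_derivative_transform_within_open[OF H[OF that] N that(1)]) (simp add: first)
  have second: "partial_deriv b' (partial_deriv b f) y = H b y b'" if "y \<in> N" "b \<in> Basis" for y b b'
    using frechet_derivative_at[OF second_deriv[OF that]] by metis
  have "continuous_on N (partial_deriv b' (partial_deriv b f))" if "b \<in> Basis" "b' \<in> Basis" for b b'
    using cont[OF that] by (rule continuous_on_eq) (simp add: second that)
  then show "Ck_on 2 f N"
    unfolding numeral_2_eq_2 using differentiableI[OF D] differentiableI[OF second_deriv] by simp
  show "laplacian f x = (\<Sum>b\<in>Basis. H b x b)" if "x \<in> N"
    unfolding laplacian_def by (rule sum.cong) (use second that in auto)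
qed

lemma quadratic_composition:
  fixes w z :: "'a::euclidean_space" and q k :: real and F F' F'' :: "real \<Rightarrow> real"
  defines "Q x \<equiv> q + w \<bullet> (x - z) + k * (norm (x - z))\<^sup>2"
    and "G x \<equiv> w + (2 * k) *\<^sub>R (x - z)"
  assumes F: "\<And>t. t \<in> I \<Longrightarrow> (F has_real_derivative F' t) (at t)"
    and F': "\<And>t. t \<in> I \<Longrightarrow> (F' has_real_derivative F'' t) (at t)"
    and F'': "\<And>t. t \<in> I \<Longrightarrow> isCont F'' t"
    and N: "open N" "\<And>x. x \<in> N \<Longrightarrow> Q x \<in> I"
  shows "Ck_on 2 (\<lambda>x. F (Q x)) N"
    and "x \<in> N \<Longrightarrow>
      laplacian (\<lambda>x. F (Q x)) x = F'' (Q x) * (norm (G x))\<^sup>2 + F' (Q x) * (2 * k * real DIM('a))"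
proof -
  have Q: "(Q has_derivative (\<lambda>h. G x \<bullet> h)) (at x)" for x
    unfolding Q_def G_def power2_norm_eq_inner
    by (auto intro!: derivative_eq_intros simp: algebra_simps inner_commute)
  have FQ: "((\<lambda>x. F (Q x)) has_derivative (\<lambda>h. (F' (Q x) *\<^sub>R G x) \<bullet> h)) (at x)" if "x \<in> N" for x
    using DERIV_compose_FDERIV[OF F[OF N(2)[OF that]] Q] by (simp add: mult.commute)
  have F'Q: "((\<lambda>x. F' (Q x)) has_derivative (\<lambda>h. F'' (Q x) * (G x \<bullet> h))) (at x)" if "x \<in> N" for x
    using DERIV_compose_FDERIV[OF F'[OF N(2)[OF that]] Q] by (simp add: mult.commute)
  define H where "H b x h = F'' (Q x) * (G x \<bullet> h) * (G x \<bullet> b) + F' (Q x) * (2 * k * (h \<bullet> b))" for b x h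
  have H: "((\<lambda>y. (F' (Q y) *\<^sub>R G y) \<bullet> b) has_derivative H b x) (at x)" if "x \<in> N" for x b
  proof -
    have "((\<lambda>y. G y \<bullet> b) has_derivative (\<lambda>h. 2 * k * (h \<bullet> b))) (at x)"
      unfolding G_def by (auto intro!: derivative_eq_intros)
    from has_derivative_mult[OF F'Q[OF that] this] show ?thesis
      unfolding H_def inner_scaleR_left by (simp add: algebra_simps)
  qed
  have contQ: "continuous_on N Q" "continuous_on N G"
    unfolding Q_def G_def by (intro continuous_intros)+
  have contF: "continuous_on N (\<lambda>x. F'' (Q x))" "continuous_on N (\<lambda>x. F' (Q x))"
    by (rule continuous_on_compose2[OF _ contQ(1), of "Q ` N"];
        use F'' F' N(2) DERIV_isCont in \<open>fastforce intro!: continuous_at_imp_continuous_on\<close>)+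
  have "continuous_on N (\<lambda>x. H b x b')" for b b'
    unfolding H_def by (intro continuous_intros contQ contF)
  note * = Ck_on_2_laplacian[where D = "\<lambda>x. F' (Q x) *\<^sub>R G x" and H = H, OF N(1) FQ H this]
  show "Ck_on 2 (\<lambda>x. F (Q x)) N" by (rule *(1))
  show "laplacian (\<lambda>x. F (Q x)) x = F'' (Q x) * (norm (G x))\<^sup>2 + F' (Q x) * (2 * k * real DIM('a))" if "x \<in> N"
  proof -
    have "laplacian (\<lambda>x. F (Q x)) x = (\<Sum>b\<in>Basis. H b x b)" by (rule *(2)) (use that in auto)
    also have "\<dots> = F'' (Q x) * (\<Sum>b\<in>Basis. (G x \<bullet> b) * (G x \<bullet> b)) + F' (Q x) * (2 * k * real DIM('a))"
      by (simp add: H_def sum.distrib sum_distrib_left mult.assoc)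
    also have "(\<Sum>b\<in>Basis. (G x \<bullet> b) * (G x \<bullet> b)) = (norm (G x))\<^sup>2"
      by (simp add: power2_norm_eq_inner euclidean_inner[of "G x" "G x"])
    finally show ?thesis .
  qed
qed

text \<open>In the application, \<open>a\<close> is the squared gradient of a paraboloid,
  \<open>b\<close> is \<open>t\<close> times its Laplacian and \<open>d\<close> the regularized
  distance. The 10 comes from \<open>1 / y\<^sup>2 - 1\<close> with \<open>y = d / t\<close> between
  1/2 and 3/2, bounded by \<open>\<delta> * (5 / 2) / (1 / 4)\<close>; the other two errors have
  factor 1.\<close>

lemma perturbed_barrier_inequality:
  fixes P \<delta> s \<kappa> t d a b :: real
  assumes P: "P + 10 * \<delta> * (\<bar>P\<bar> + \<bar>s\<bar> + \<bar>\<kappa>\<bar>) < \<kappa>"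
    and \<delta>: "\<delta> \<le> 1 / 2" and t: "0 < t"
    and a: "\<bar>a - 1\<bar> \<le> \<delta>" and b: "\<bar>b\<bar> \<le> \<delta>" and d: "\<bar>d / t - 1\<bar> \<le> \<delta>"
  shows "P * a + s * b < \<kappa> * t\<^sup>2 / d\<^sup>2"
proof -
  define y where "y = d / t"
  have y: "1 / 2 \<le> y" "y \<le> 3 / 2" using d \<delta> unfolding y_def by linarith+
  have y2: "1 / 4 \<le> y\<^sup>2" using power_mono[of "1 / 2" y 2] y by (simp add: power2_eq_square)
  have "1 / y\<^sup>2 - 1 = (1 - y) * (1 + y) / y\<^sup>2" using y by (simp add: field_simps power2_eq_square)
  then have "\<bar>1 / y\<^sup>2 - 1\<bar> = \<bar>1 - y\<bar> * (1 + y) / y\<^sup>2" using y by (simp add: abs_mult)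
  also have "\<dots> \<le> \<delta> * (5 / 2) / (1 / 4)"
    using y y2 d unfolding y_def[symmetric] by (intro frac_le mult_mono) (auto simp: abs_minus_commute)
  finally have "\<bar>1 / y\<^sup>2 - 1\<bar> \<le> 10 * \<delta>" by simp
  then have "\<bar>\<kappa>\<bar> * \<bar>1 / y\<^sup>2 - 1\<bar> \<le> \<bar>\<kappa>\<bar> * (10 * \<delta>)" by (intro mult_left_mono) auto
  then have "\<bar>\<kappa> * (1 / y\<^sup>2 - 1)\<bar> \<le> \<bar>\<kappa>\<bar> * (10 * \<delta>)" by (simp add: abs_mult)
  then have 1: "\<kappa> - \<kappa> * (1 / y\<^sup>2) \<le> 10 * (\<delta> * \<bar>\<kappa>\<bar>)" by (simp add: right_diff_distrib mult_ac)
  have "\<bar>P * (a - 1)\<bar> \<le> \<bar>P\<bar> * \<delta>" "\<bar>s * b\<bar> \<le> \<bar>s\<bar> * \<delta>"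
    unfolding abs_mult using a b by (intro mult_left_mono; simp)+
  then have 2: "P * a - P \<le> \<delta> * \<bar>P\<bar>" "s * b \<le> \<delta> * \<bar>s\<bar>" by (simp_all add: right_diff_distrib mult_ac)
  have "0 \<le> \<delta>" using b by linarith
  then have 3: "0 \<le> \<delta> * \<bar>P\<bar>" "0 \<le> \<delta> * \<bar>s\<bar>" by auto
  have "10 * \<delta> * (\<bar>P\<bar> + \<bar>s\<bar> + \<bar>\<kappa>\<bar>) = 10 * (\<delta> * \<bar>P\<bar>) + 10 * (\<delta> * \<bar>s\<bar>) + 10 * (\<delta> * \<bar>\<kappa>\<bar>)"
    by (simp add: algebra_simps)
  then have "P * a + s * b < \<kappa> * (1 / y\<^sup>2)" using P 1 2 3 by linarith
  also have "\<kappa> * (1 / y\<^sup>2) = \<kappa> * t\<^sup>2 / d\<^sup>2" by (simp add: y_def power_divide)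
  finally show ?thesis .
qed

context graph_domain
begin

text \<open>The infimum (\<open>c = 1\<close>) or supremum (\<open>c = -1\<close>) over \<open>z\<close> of these functions is a substitute
  for the distance; which of the two is needed depends on whether the barrier is increasing or
  decreasing. The factor \<open>height z powr (\<alpha> - 1)\<close> is the size of the second derivatives of a
  \<open>C\<^sup>1\<^sup>,\<^sup>\<alpha>\<close> function regularized at scale \<open>height z\<close>, and 100 is large enough for the optimal \<open>z\<close>
  to lie within distance \<open>height z / 8\<close> of \<open>x\<close>.\<close>

definition paraboloid :: "real \<Rightarrow> 'a \<Rightarrow> 'a \<Rightarrow> real"
  where "paraboloid c z x =
    tangent z x / slope z + c * 100 * height z powr (\<alpha> - 1) * (norm (x - z))\<^sup>2"

lemma paraboloid_self: "paraboloid c x x = height x / slope x"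
  by (simp add: paraboloid_def)

text \<open>A center at distance \<open>q > height z / 8\<close> changes the affine part by at most
  \<open>(q + height x) * q powr \<alpha>\<close>, which is at most
  \<open>11 * q powr (1 + \<alpha>)\<close> since \<open>height x \<le> height z + 2 * q\<close>.
  The quadratic penalty is at least 100/8 times \<open>q powr (1 + \<alpha>)\<close>, so such a
  center is worse than \<open>x\<close> itself.\<close>

lemma paraboloid_optimal_center:
  assumes c: "\<bar>c\<bar> = 1" and x: "norm x < 2" "0 < height x" and z: "norm z < 2" "0 < height z"
    and le: "c * paraboloid c z x \<le> c * paraboloid c x x"
  shows "norm (x - z) \<le> height z / 8"
proof (rule ccontr)
  define q where "q = norm (x - z)"
  define U where "U = height z"
  assume "\<not> ?thesis"
  then have q: "U / 8 < q" "0 < q" "0 < U" using z by (auto simp: q_def U_def)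
  have cc: "c * c = 1" using c by (metis abs_mult_self_eq mult_1)
  define E where "E = tangent z x / slope z - height x / slope x"
  have "c * E + (c * c) * (100 * U powr (\<alpha> - 1) * q\<^sup>2) \<le> 0"
    using le unfolding paraboloid_self by (simp add: paraboloid_def E_def U_def q_def algebra_simps)
  then have "100 * U powr (\<alpha> - 1) * q\<^sup>2 \<le> - (c * E)" using cc by simp
  also have "\<dots> \<le> \<bar>E\<bar>" using abs_ge_minus_self[of "c * E"] c by (simp add: abs_mult)
  also have "\<dots> \<le> q powr (1 + \<alpha>) + \<bar>height x\<bar> * q powr \<alpha>"
    unfolding E_def q_def by (rule tangent_height_quotient[OF x(1) z(1)])
  also have "\<dots> = (q + height x) * q powr \<alpha>" using q x by (simp add: powr_Suc_exponent algebra_simps)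
  also have "\<dots> \<le> (11 * q) * q powr \<alpha>"
    using height_lipschitz[OF x(1) z(1)] q by (intro mult_right_mono) (auto simp: q_def[symmetric] U_def[symmetric])
  finally have 1: "100 * U powr (\<alpha> - 1) * q\<^sup>2 \<le> 11 * q * q powr \<alpha>" .
  have "100 * (U powr (\<alpha> - 1) * q powr (1 - \<alpha>)) * (q * q powr \<alpha>) = 100 * U powr (\<alpha> - 1) * q\<^sup>2"
  proof -
    have "q powr (1 - \<alpha>) * q powr \<alpha> = q" using q by (simp add: powr_add[symmetric])
    then show ?thesis by (simp add: power2_eq_square)
  qed
  then have "100 * (U powr (\<alpha> - 1) * q powr (1 - \<alpha>)) * (q * q powr \<alpha>) \<le> 11 * (q * q powr \<alpha>)"
    using 1 by (simp only: mult.assoc)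
  then have 2: "100 * (U powr (\<alpha> - 1) * q powr (1 - \<alpha>)) \<le> 11"
    using q by (subst (asm) mult_le_cancel_right_pos) auto
  have "1 / 8 \<le> (1 / 8) powr (1 - \<alpha>)"
    using powr_mono'[of "1 - \<alpha>" 1 "1 / 8 :: real"] \<alpha>_pos by simp
  also have "\<dots> \<le> (q / U) powr (1 - \<alpha>)"
    using q \<alpha>_less by (intro powr_mono2) (auto simp: field_simps)
  also have "\<dots> = U powr (\<alpha> - 1) * q powr (1 - \<alpha>)"
    using q powr_minus_divide[of U "1 - \<alpha>"] by (simp add: powr_divide)
  finally show False using 2 by simp
qed

context
  fixes c :: real and x z :: 'a
  assumes c: "\<bar>c\<bar> = 1" and x: "norm x \<le> 1 / 20" "0 < height x"
    and small: "12800 * real DIM('a) * height x powr \<alpha> \<le> 1"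
    and z: "norm (x - z) \<le> height x / 4"
begin

lemma height_powr_small: "12800 * height x powr \<alpha> \<le> 1"
proof -
  have "12800 * 1 * height x powr \<alpha> \<le> 12800 * real DIM('a) * height x powr \<alpha>"
    by (intro mult_right_mono mult_left_mono) (auto simp: Suc_leI)
  then show ?thesis using small by simp
qed

lemma near_center:
  shows "norm z < 2" "height x / 2 \<le> height z" "height z \<le> 3 / 2 * height x"
proof -
  have "height x \<le> 1 / 10" using height_le[of x] x by auto
  then show *: "norm z < 2" using norm_triangle_sub[of z x] z x by (simp add: norm_minus_commute)
  show "height x / 2 \<le> height z" "height z \<le> 3 / 2 * height x"
    using height_lipschitz[of x z] * z x by auto
qed

lemma curvature_le: "height z powr (\<alpha> - 1) \<le> 2 * height x powr (\<alpha> - 1)"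
proof -
  have "height z powr (\<alpha> - 1) \<le> (height x / 2) powr (\<alpha> - 1)"
    using near_center x \<alpha>_less by (intro powr_mono2') auto
  also have "\<dots> = 2 powr (1 - \<alpha>) * height x powr (\<alpha> - 1)"
    using x powr_minus_divide[of 2 "1 - \<alpha>"] by (simp add: powr_divide)
  also have "\<dots> \<le> 2 powr 1 * height x powr (\<alpha> - 1)"
    using \<alpha>_pos by (intro mult_right_mono powr_mono) auto
  finally show ?thesis by simp
qed

lemma height_powr_pred: "height x powr (\<alpha> - 1) * height x = height x powr \<alpha>"
  using x powr_add[of "height x" "\<alpha> - 1" 1] by simp

text \<open>The affine part contributes 2, the quadratic part 100 * 2 / 16.\<close>

lemma paraboloid_approx: "\<bar>paraboloid c z x - height x / slope x\<bar> \<le> 15 * height x powr (1 + \<alpha>)"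
proof -
  define u where "u = height x"
  define q where "q = norm (x - z)"
  have u: "0 < u" and q: "0 \<le> q" "q \<le> u / 4" using x z by (auto simp: u_def q_def)
  have "\<bar>tangent z x / slope z - u / slope x\<bar> \<le> q powr (1 + \<alpha>) + u * q powr \<alpha>"
    using tangent_height_quotient[of x z] near_center x by (simp add: u_def q_def)
  also have "\<dots> \<le> u powr (1 + \<alpha>) + u * u powr \<alpha>"
    using q u \<alpha>_pos by (intro add_mono mult_left_mono powr_mono2) auto
  finally have 1: "\<bar>tangent z x / slope z - u / slope x\<bar> \<le> 2 * u powr (1 + \<alpha>)"
    using u by (simp add: powr_Suc_exponent)
  have "height z powr (\<alpha> - 1) * q\<^sup>2 \<le> (2 * u powr (\<alpha> - 1)) * (u / 4)\<^sup>2"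
    using curvature_le q by (intro mult_mono power_mono) (auto simp: u_def)
  also have "\<dots> = (u powr (\<alpha> - 1) * u) * u / 8" by (simp add: power2_eq_square)
  also have "\<dots> = u powr (1 + \<alpha>) / 8"
    using height_powr_pred u by (simp add: u_def powr_Suc_exponent)
  finally have 2: "height z powr (\<alpha> - 1) * q\<^sup>2 \<le> u powr (1 + \<alpha>) / 8" .
  have "\<bar>c * 100 * height z powr (\<alpha> - 1) * q\<^sup>2\<bar> = 100 * (height z powr (\<alpha> - 1) * q\<^sup>2)"
    using c by (simp add: abs_mult)
  then show ?thesis using 1 2 unfolding paraboloid_def u_def[symmetric] q_def[symmetric] by linarith
qed

lemma paraboloid_bounds:
  shows "height x / 4 \<le> paraboloid c z x" "paraboloid c z x \<le> 2 * height x"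
proof -
  have "height x powr (1 + \<alpha>) = height x * height x powr \<alpha>" using x by (simp add: powr_Suc_exponent)
  also have "\<dots> \<le> height x * (1 / 12800)"
    using height_powr_small x by (intro mult_left_mono) auto
  finally have "15 * height x powr (1 + \<alpha>) \<le> height x / 4" using x by simp
  moreover have "height x / 2 \<le> height x / slope x" "height x / slope x \<le> height x / 1"
    using slope_bounds[of x] x by (intro divide_left_mono; simp)+
  ultimately show "height x / 4 \<le> paraboloid c z x" "paraboloid c z x \<le> 2 * height x"
    using paraboloid_approx x by (simp_all add: abs_le_iff)
qed

lemma height_powr_le: "height x powr \<alpha> \<le> 4 * paraboloid c z x powr \<alpha>"
    and height_powr_Suc_le: "height x powr (1 + \<alpha>) \<le> 16 * paraboloid c z x powr (1 + \<alpha>)"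
    and paraboloid_powr_le: "paraboloid c z x powr \<alpha> \<le> 2 * height x powr \<alpha>"
  using scaled_powr_le[of "height x" 4 "paraboloid c z x" \<alpha>]
    scaled_powr_Suc_le[of "height x" 4 "paraboloid c z x" \<alpha>]
    scaled_powr_le[of "paraboloid c z x" 2 "height x" \<alpha>]
    paraboloid_bounds x \<alpha>_pos \<alpha>_less by auto

text \<open>The gradient is a unit normal plus a vector of length at most
  \<open>100 * height x powr \<alpha> \<le> 1\<close>. Squaring costs a factor 3 and passing from
  \<open>height x\<close> to the paraboloid a factor 4.\<close>

lemma paraboloid_gradient:
  "\<bar>(norm ((1 / slope z) *\<^sub>R nrm z + (2 * (c * 100 * height z powr (\<alpha> - 1))) *\<^sub>R (x - z)))\<^sup>2 - 1\<bar>
    \<le> 1200 * paraboloid c z x powr \<alpha>"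
proof -
  define G where "G = (1 / slope z) *\<^sub>R nrm z + (2 * (c * 100 * height z powr (\<alpha> - 1))) *\<^sub>R (x - z)"
  define \<beta> where "\<beta> = 200 * height z powr (\<alpha> - 1) * norm (x - z)"
  have "slope z \<noteq> 0" using slope_bounds[OF near_center(1)] by linarith
  then have "norm ((1 / slope z) *\<^sub>R nrm z) = 1" by (simp add: slope_def)
  moreover have "norm ((2 * (c * 100 * height z powr (\<alpha> - 1))) *\<^sub>R (x - z)) = \<beta>"
    using c by (simp add: \<beta>_def abs_mult)
  ultimately have G: "\<bar>norm G - 1\<bar> \<le> \<beta>"
    unfolding G_def by (smt (verit) norm_diff_ineq norm_triangle_ineq)
  have "\<beta> \<le> 200 * (2 * height x powr (\<alpha> - 1)) * (height x / 4)"
    unfolding \<beta>_def using curvature_le z by (intro mult_mono) auto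
  also have "\<dots> = 100 * height x powr \<alpha>" unfolding height_powr_pred[symmetric] by simp
  finally have \<beta>: "\<beta> \<le> 100 * height x powr \<alpha>" .
  then have \<beta>1: "\<beta> \<le> 1" using height_powr_small by simp
  have "(norm G)\<^sup>2 - 1 = (norm G - 1) * (norm G + 1)" by (simp add: power2_eq_square algebra_simps)
  then have "\<bar>(norm G)\<^sup>2 - 1\<bar> = \<bar>norm G - 1\<bar> * (norm G + 1)" by (simp add: abs_mult)
  also have "\<dots> \<le> \<beta> * 3" using G \<beta>1 by (intro mult_mono) auto
  also have "\<dots> \<le> 1200 * paraboloid c z x powr \<alpha>" using \<beta> height_powr_le by linarith
  finally show ?thesis unfolding G_def .
qed

lemma paraboloid_laplacian:
  "\<bar>paraboloid c z x * (2 * (c * 100 * height z powr (\<alpha> - 1)) * real DIM('a))\<bar>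
    \<le> 3200 * real DIM('a) * paraboloid c z x powr \<alpha>"
proof -
  have pos: "0 \<le> paraboloid c z x" using paraboloid_bounds x by simp
  have "\<bar>paraboloid c z x * (2 * (c * 100 * height z powr (\<alpha> - 1)) * real DIM('a))\<bar>
      = 200 * real DIM('a) * (paraboloid c z x * height z powr (\<alpha> - 1))"
    using c pos by (simp add: abs_mult)
  also have "\<dots> \<le> 200 * real DIM('a) * ((2 * height x) * (2 * height x powr (\<alpha> - 1)))"
    using paraboloid_bounds curvature_le pos x by (intro mult_left_mono mult_mono) auto
  also have "\<dots> = 800 * real DIM('a) * height x powr \<alpha>" unfolding height_powr_pred[symmetric] by simp
  also have "\<dots> \<le> 800 * real DIM('a) * (4 * paraboloid c z x powr \<alpha>)"
    using height_powr_le by (intro mult_left_mono) auto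
  finally show ?thesis by simp
qed

text \<open>Source of the constant 12800 = 2 * 2 * 3200: the common bound for the three relative
  errors has to be at most 1/2.\<close>

lemma paraboloid_small: "3200 * real DIM('a) * paraboloid c z x powr \<alpha> \<le> 1 / 2"
proof -
  have "3200 * real DIM('a) * paraboloid c z x powr \<alpha> \<le> 3200 * real DIM('a) * (2 * height x powr \<alpha>)"
    using paraboloid_powr_le by (intro mult_left_mono) auto
  also have "\<dots> = 12800 * real DIM('a) * height x powr \<alpha> / 2" by simp
  also have "\<dots> \<le> 1 / 2" using small by (intro divide_right_mono) auto
  finally show ?thesis .
qed

text \<open>Both quantities are compared with \<open>height x / slope x\<close>: 75 + 15 = 90, and a
  factor 16 converts the height into the paraboloid.\<close>

lemma reg_dist_paraboloid:
  assumes "radial_mollifier \<phi>"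
  shows "\<bar>reg_dist \<phi> \<Omega> x / paraboloid c z x - 1\<bar> \<le> 3200 * real DIM('a) * paraboloid c z x powr \<alpha>"
proof -
  define t where "t = paraboloid c z x"
  have t: "0 < t" using paraboloid_bounds x by (simp add: t_def)
  have "\<bar>reg_dist \<phi> \<Omega> x - height x / slope x\<bar> \<le> 75 * height x powr (1 + \<alpha>)"
    by (rule reg_dist_approx[OF assms x]) (use height_powr_small in simp)
  then have "\<bar>reg_dist \<phi> \<Omega> x - t\<bar> \<le> 90 * height x powr (1 + \<alpha>)"
    using paraboloid_approx unfolding t_def by linarith
  then have "\<bar>reg_dist \<phi> \<Omega> x - t\<bar> \<le> 1440 * t powr (1 + \<alpha>)"
    using height_powr_Suc_le unfolding t_def by linarith
  then have "\<bar>reg_dist \<phi> \<Omega> x - t\<bar> \<le> (1440 * t powr \<alpha>) * t" using t by (simp add: powr_Suc_exponent mult_ac)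
  moreover have "reg_dist \<phi> \<Omega> x / t - 1 = (reg_dist \<phi> \<Omega> x - t) / t" using t by (simp add: field_simps)
  ultimately have "\<bar>reg_dist \<phi> \<Omega> x / t - 1\<bar> \<le> 1440 * t powr \<alpha>" using t by (simp add: pos_divide_le_eq)
  also have "\<dots> \<le> 3200 * real DIM('a) * t powr \<alpha>"
  proof -
    have "1 \<le> real DIM('a)" by (simp add: Suc_leI)
    then have "1440 \<le> 3200 * real DIM('a)" by linarith
    then show ?thesis by (intro mult_right_mono) simp_all
  qed
  finally show ?thesis unfolding t_def .
qed

end

end

section \<open>The maximum principle\<close>

lemma barrierD:
  assumes "barrier \<kappa> \<alpha> C t\<^sub>1 c \<Lambda> s s'" "0 < t" "t < t\<^sub>1"
  shows "(\<Lambda> has_real_derivative s t / t) (at t)" "(s has_real_derivative s' t) (at t)"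
    "isCont s' t" "0 < c * s t"
    "(s t)\<^sup>2 - s t + t * s' t + C * t powr \<alpha> * (\<bar>(s t)\<^sup>2 - s t + t * s' t\<bar> + \<bar>s t\<bar> + \<bar>\<kappa>\<bar>) < \<kappa>"
  using assms unfolding barrier_def by blast+

text \<open>Converts an inequality between barrier values into the signed inequality between
  paraboloids that \<open>paraboloid_optimal_center\<close> expects.\<close>

lemma barrier_monotone:
  assumes bar: "barrier \<kappa> \<alpha> C t\<^sub>1 c \<Lambda> s s'" and c: "\<bar>c\<bar> = 1"
    and a: "0 < a" "a < t\<^sub>1" and b: "0 < b" "b < t\<^sub>1" and le: "\<Lambda> a \<le> \<Lambda> b"
  shows "c * a \<le> c * b"
proof -
  have D: "((\<lambda>t. c * \<Lambda> t) has_real_derivative c * s t / t) (at t)" "0 < c * s t / t"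
    if "0 < t" "t < t\<^sub>1" for t
    using barrierD[OF bar that] that by (auto intro!: derivative_eq_intros)
  have mono: "c * \<Lambda> p < c * \<Lambda> q" if "p < q" "0 < p" "q < t\<^sub>1" for p q
  proof (rule DERIV_pos_imp_increasing[OF \<open>p < q\<close>])
    fix t assume "p \<le> t" "t \<le> q"
    then have "0 < t" "t < t\<^sub>1" using that by auto
    then show "\<exists>y. ((\<lambda>t. c * \<Lambda> t) has_real_derivative y) (at t) \<and> 0 < y" using D by blast
  qed
  consider "c = 1" | "c = - 1" using c by linarith
  then show ?thesis
    using mono[of a b] mono[of b a] a b le by cases (auto simp: not_less[symmetric])
qed

context graph_domain
begin

text \<open>32000 is the factor 10 of \<open>perturbed_barrier_inequality\<close> times the common
  error constant 3200. Heights in the ball are at most \<open>2 * r\<close> and paraboloid values at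
  most \<open>4 * r\<close>, which explains the conditions on \<open>r\<close>.\<close>

lemma comparison:
  assumes \<phi>: "radial_mollifier \<phi>"
    and bar: "barrier \<kappa> \<alpha> (32000 * real DIM('a)) t\<^sub>1 c \<Lambda> s s'" and c: "\<bar>c\<bar> = 1"
    and r: "0 < r" "r \<le> 1 / 20" "12800 * real DIM('a) * (2 * r) powr \<alpha> \<le> 1" "4 * r < t\<^sub>1"
    and c0: "0 < c\<^sub>0"
    and B: "\<And>t d. 0 < t \<Longrightarrow> t < t\<^sub>1 \<Longrightarrow> t / 2 \<le> d \<Longrightarrow> d \<le> 2 * t \<Longrightarrow> 0 < B d \<and> c\<^sub>0 * B d \<le> exp (\<Lambda> t)"
    and cont: "continuous_on (\<Omega> \<inter> ball 0 1) v"
    and subsol: "viscosity_subsolution (\<Omega> \<inter> ball 0 1) (\<lambda>x. \<kappa> / (reg_dist \<phi> \<Omega> x)\<^sup>2) v"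
    and boundary: "boundary_limsup_nonpos \<Omega> (\<lambda>x. v x / B (reg_dist \<phi> \<Omega> x))"
    and sphere: "\<forall>x\<in>\<Omega> \<inter> sphere 0 r. v x \<le> 0"
    and y: "y \<in> \<Omega> \<inter> ball 0 r"
  shows "v y \<le> 0"
proof (rule ccontr)
  assume vy: "\<not> v y \<le> 0"
  let ?d = "reg_dist \<phi> \<Omega>"
  \<comment> \<open>The constraint on the center is closed, for compactness; a maximizing pair will
    satisfy it strictly.\<close>
  define adm where "adm x z \<longleftrightarrow> norm x \<le> r \<and> 0 < height x \<and> norm (x - z) \<le> height x / 4" for x z
  define T where "T x z = paraboloid c z x" for x z
  define W where "W x z = exp (\<Lambda> (T x z))" for x z
  have D: "1 \<le> real DIM('a)" by (simp add: Suc_leI)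
  have adm1: "norm x \<le> 1 / 20" "0 < height x" "12800 * real DIM('a) * height x powr \<alpha> \<le> 1" "norm (x - z) \<le> height x / 4"
    if "adm x z" for x z
  proof -
    show "norm x \<le> 1 / 20" "0 < height x" "norm (x - z) \<le> height x / 4"
      using that r by (auto simp: adm_def)
    then have "height x powr \<alpha> \<le> (2 * r) powr \<alpha>"
      using height_le[of x] \<alpha>_pos that by (intro powr_mono2) (auto simp: adm_def)
    then have "12800 * real DIM('a) * height x powr \<alpha> \<le> 12800 * real DIM('a) * (2 * r) powr \<alpha>"
      by (intro mult_left_mono) auto
    then show "12800 * real DIM('a) * height x powr \<alpha> \<le> 1" using r by linarith
  qed
  have T: "0 < T x z" "T x z < t\<^sub>1" if "adm x z" for x z
    using paraboloid_bounds[OF c adm1[OF that]] height_le[of x] adm1[OF that] that r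
    unfolding T_def adm_def by auto
  have dT: "T x z / 2 \<le> ?d x" "?d x \<le> 2 * T x z" if "adm x z" for x z
  proof -
    have "\<bar>?d x / T x z - 1\<bar> \<le> 1 / 2"
      unfolding T_def using reg_dist_paraboloid[OF c adm1[OF that] \<phi>] paraboloid_small[OF c adm1[OF that]]
      by linarith
    then have "1 / 2 \<le> ?d x / T x z" "?d x / T x z \<le> 2" by linarith+
    then show "T x z / 2 \<le> ?d x" "?d x \<le> 2 * T x z"
      using T[OF that] by (auto simp: field_simps)
  qed
  have B': "0 < B (?d x)" "c\<^sub>0 * B (?d x) \<le> W x z" if "adm x z" for x z
    using B[OF T[OF that] dT[OF that]] by (auto simp: W_def)
  have W: "0 < W x z" for x z by (simp add: W_def)
  have mem: "x \<in> \<Omega>" "x \<in> ball 0 1" if "adm x z" for x z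
    using mem_\<Omega>_iff[of x] that r by (auto simp: adm_def)
  have admy: "adm y y" using y mem_\<Omega>_iff[of y] r by (auto simp: adm_def)
  define m where "m = v y / W y y"
  have m: "0 < m" using vy W by (simp add: m_def)

  \<comment> \<open>Ratios near the boundary\<close>
  obtain \<eta> where \<eta>: "0 < \<eta>" "\<And>x z. adm x z \<Longrightarrow> height x < \<eta> \<Longrightarrow> v x / W x z < m"
  proof (rule ccontr)
    assume "\<not> thesis"
    then have "\<exists>x z. adm x z \<and> height x < inverse (real (Suc k)) \<and> m \<le> v x / W x z" for k
      using that[of "inverse (real (Suc k))"] by (meson inverse_positive_iff_positive not_less of_nat_0_less_iff zero_less_Suc)
    then obtain X Z where XZ: "\<And>k. adm (X k) (Z k)" "\<And>k. height (X k) < inverse (real (Suc k))"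
        "\<And>k. m \<le> v (X k) / W (X k) (Z k)"
      by metis
    \<comment> \<open>The boundary condition is pointwise, so uniformity comes from compactness: a
      subsequence tends to a point of zero height, inside \<open>ball 0 1\<close> because
      \<open>r\<close> is small.\<close>
    have "X k \<in> cball 0 r" for k using XZ(1)[of k] by (simp add: adm_def)
    then obtain p \<sigma> where p: "p \<in> cball 0 r" "strict_mono \<sigma>" "(X \<circ> \<sigma>) \<longlonglongrightarrow> p"
      using compact_cball[of "0::'a" r] unfolding compact_def by meson
    have p2: "p \<in> ball 0 2" "p \<in> ball 0 1" using p r by auto
    then have "isCont height p" using continuous_on_height continuous_on_eq_continuous_at open_ball by blast
    then have "(\<lambda>k. height (X (\<sigma> k))) \<longlonglongrightarrow> height p"
      using p(3) isCont_tendsto_compose[of p height "X \<circ> \<sigma>"] by (simp add: o_def)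
    moreover have "(\<lambda>k. height (X k)) \<longlonglongrightarrow> 0"
    proof (rule tendsto_sandwich[OF _ _ tendsto_const LIMSEQ_inverse_real_of_nat])
      show "\<forall>\<^sub>F k in sequentially. 0 \<le> height (X k)"
        using adm1(2)[OF XZ(1)] by (intro always_eventually allI less_imp_le)
      show "\<forall>\<^sub>F k in sequentially. height (X k) \<le> inverse (real (Suc k))"
        using XZ(2) by (intro always_eventually allI less_imp_le)
    qed
    then have "(\<lambda>k. height (X (\<sigma> k))) \<longlonglongrightarrow> 0"
      using LIMSEQ_subseq_LIMSEQ[OF _ p(2)] by (force simp: o_def)
    ultimately have hp: "height p = 0" using LIMSEQ_unique by blast
    then have "p \<in> frontier \<Omega> \<inter> ball 0 1" using mem_frontier_iff[of p] p2 by auto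
    then have "Limsup (at p within \<Omega> \<inter> ball 0 1) (\<lambda>x. ereal (v x / B (?d x))) \<le> 0"
      using boundary unfolding boundary_limsup_nonpos_def by blast
    also have "0 < ereal (m * c\<^sub>0)" using m c0 by simp
    finally have "\<forall>\<^sub>F x in at p within \<Omega> \<inter> ball 0 1. ereal (v x / B (?d x)) < ereal (m * c\<^sub>0)"
      by (rule Limsup_lessD)
    moreover have "filterlim (X \<circ> \<sigma>) (at p within \<Omega> \<inter> ball 0 1) sequentially"
      unfolding filterlim_at
    proof
      have "(X \<circ> \<sigma>) k \<in> \<Omega> \<inter> ball 0 1 \<and> (X \<circ> \<sigma>) k \<noteq> p" for k
        using mem[OF XZ(1)[of "\<sigma> k"]] adm1(2)[OF XZ(1)[of "\<sigma> k"]] hp by auto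
      then show "\<forall>\<^sub>F k in sequentially. (X \<circ> \<sigma>) k \<in> \<Omega> \<inter> ball 0 1 \<and> (X \<circ> \<sigma>) k \<noteq> p" by simp
    qed (rule p(3))
    ultimately have "\<forall>\<^sub>F k in sequentially. ereal (v ((X \<circ> \<sigma>) k) / B (?d ((X \<circ> \<sigma>) k))) < ereal (m * c\<^sub>0)"
      by (rule eventually_compose_filterlim)
    then obtain k where "v (X k) / B (?d (X k)) < m * c\<^sub>0"
      by (auto simp: eventually_sequentially)
    then have "v (X k) < m * (c\<^sub>0 * B (?d (X k)))"
      using B'(1)[OF XZ(1)[of k]] by (simp add: pos_divide_less_eq mult_ac)
    also have "\<dots> \<le> m * W (X k) (Z k)"
      using B'(2)[OF XZ(1)[of k]] m by (intro mult_left_mono) auto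
    also have "\<dots> \<le> v (X k)" using XZ(3)[of k] W[of "X k" "Z k"] by (simp add: pos_le_divide_eq)
    finally show False by simp
  qed

  \<comment> \<open>Existence of a maximizing pair\<close>
  define S where "S = cball (0::'a) r \<times> cball (0::'a) 1"
  define K where "K = S \<inter> ((S \<inter> (\<lambda>p. height (fst p)) -` {\<eta>..}) \<inter>
      (S \<inter> ((\<lambda>p. height (fst p) / 4 - norm (fst p - snd p)) -` {0..})))"
  have S_sub: "fst ` S \<subseteq> ball 0 2" "snd ` S \<subseteq> ball 0 2" using r by (auto simp: S_def)
  have contS: "continuous_on S (\<lambda>p. height (fst p))"
    by (rule continuous_on_compose2[OF continuous_on_height _ S_sub(1)]) (intro continuous_intros)
  have S: "closed S" "compact S" by (auto simp: S_def intro: closed_Times compact_Times)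
  have "closed (S \<inter> ((\<lambda>p. height (fst p)) -` {\<eta>..}))"
    by (rule continuous_closed_preimage[OF contS S(1)]) simp
  moreover have "closed (S \<inter> ((\<lambda>p. height (fst p) / 4 - norm (fst p - snd p)) -` {0..}))"
    by (rule continuous_closed_preimage[OF _ S(1)]) (auto intro!: continuous_intros contS)
  ultimately have K: "compact K"
    unfolding K_def using compact_Int_closed[OF S(2)] closed_Int by blast
  have K_iff: "(x, z) \<in> K \<longleftrightarrow> adm x z \<and> \<eta> \<le> height x" for x z
  proof
    assume a: "adm x z \<and> \<eta> \<le> height x"
    have "norm z < 2" "norm z \<le> norm x + norm (x - z)"
      using near_center(1)[OF c adm1[of x z]] a norm_triangle_ineq4[of x "x - z"] by auto
    moreover have "norm x + norm (x - z) \<le> 1" using a adm1[of x z] height_le[of x] by auto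
    ultimately show "(x, z) \<in> K" using a by (auto simp: K_def S_def adm_def)
  qed (use \<eta>(1) in \<open>auto simp: K_def S_def adm_def\<close>)
  have K_sub: "fst ` K \<subseteq> ball 0 2" "snd ` K \<subseteq> ball 0 2" using S_sub by (auto simp: K_def)
  have K_adm: "adm (fst p) (snd p)" if "p \<in> K" for p using that K_iff[of "fst p" "snd p"] by simp
  have contT: "continuous_on K (\<lambda>p. T (fst p) (snd p))"
  proof -
    have h: "continuous_on K (\<lambda>p. height (snd p))"
      by (rule continuous_on_compose2[OF continuous_on_height _ K_sub(2)]) (intro continuous_intros)
    have n: "continuous_on K (\<lambda>p. nrm (snd p))"
      by (rule continuous_on_compose2[OF continuous_on_nrm _ K_sub(2)]) (intro continuous_intros)
    have "\<forall>p\<in>K. height (snd p) \<noteq> 0" "\<forall>p\<in>K. norm (nrm (snd p)) \<noteq> 0"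
      using near_center[OF c adm1[OF K_adm]] adm1(2)[OF K_adm] slope_bounds(1)
      unfolding slope_def by (smt (verit) divide_pos_pos)+
    then show ?thesis
      unfolding T_def paraboloid_def tangent_def slope_def
      by (intro continuous_intros h n)
  qed
  have cont\<Lambda>: "continuous_on {0<..<t\<^sub>1} \<Lambda>"
    using DERIV_isCont[OF barrierD(1)[OF bar]] by (intro continuous_at_imp_continuous_on) auto
  have contf: "continuous_on K (\<lambda>p. v (fst p) / W (fst p) (snd p))"
    unfolding W_def
  proof (intro continuous_intros)
    have "fst ` K \<subseteq> \<Omega> \<inter> ball 0 1" using mem[OF K_adm] by blast
    then show "continuous_on K (\<lambda>p. v (fst p))"
      by (intro continuous_on_compose2[OF cont] continuous_intros)
    show "continuous_on K (\<lambda>p. \<Lambda> (T (fst p) (snd p)))"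
      by (rule continuous_on_compose2[OF cont\<Lambda> contT]) (use T K_adm in auto)
  qed auto
  \<comment> \<open>The diagonal pair at \<open>y\<close> has ratio exactly \<open>m\<close>, so it
    is not among the pairs close to the boundary.\<close>
  have "\<not> height y < \<eta>" using \<eta>(2)[OF admy] by (auto simp: m_def)
  then have yK: "(y, y) \<in> K" using admy K_iff by simp
  then obtain q where q: "q \<in> K" "\<And>p. p \<in> K \<Longrightarrow> v (fst p) / W (fst p) (snd p) \<le> v (fst q) / W (fst q) (snd q)"
    using continuous_attains_sup[OF K _ contf] by blast
  define x\<^sub>0 where "x\<^sub>0 = fst q"
  define z\<^sub>0 where "z\<^sub>0 = snd q"
  define M where "M = v x\<^sub>0 / W x\<^sub>0 z\<^sub>0"
  have adm0: "adm x\<^sub>0 z\<^sub>0" using K_adm[OF q(1)] by (simp add: x\<^sub>0_def z\<^sub>0_def)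
  have "m \<le> M" using q(2)[OF yK] by (simp add: m_def M_def x\<^sub>0_def z\<^sub>0_def)
  then have M: "0 < M" using m by simp
  have max: "v x / W x z \<le> M" if "adm x z" for x z
  proof (cases "height x < \<eta>")
    case True then show ?thesis using \<eta>(2)[OF that] \<open>m \<le> M\<close> by fastforce
  next
    case False then show ?thesis using q(2)[of "(x, z)"] K_iff that by (simp add: M_def x\<^sub>0_def z\<^sub>0_def)
  qed
  have v0: "v x\<^sub>0 = M * W x\<^sub>0 z\<^sub>0" using W[of x\<^sub>0 z\<^sub>0] by (simp add: M_def)
  then have v0_pos: "0 < v x\<^sub>0" using M W by simp
  have "norm x\<^sub>0 \<noteq> r" using sphere v0_pos mem(1)[OF adm0] by force
  then have x0r: "norm x\<^sub>0 < r" using adm0 by (simp add: adm_def)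
  have adm00: "adm x\<^sub>0 x\<^sub>0" using adm0 by (simp add: adm_def)
  \<comment> \<open>The center \<open>x\<^sub>0\<close> itself competes. As
    \<open>v x\<^sub>0\<close> is positive, a maximal ratio means a minimal \<open>W\<close> among
    the centers.\<close>
  have "v x\<^sub>0 / W x\<^sub>0 x\<^sub>0 \<le> v x\<^sub>0 / W x\<^sub>0 z\<^sub>0" using max[OF adm00] by (simp add: M_def)
  then have "W x\<^sub>0 z\<^sub>0 \<le> W x\<^sub>0 x\<^sub>0"
    using v0_pos W[of x\<^sub>0 x\<^sub>0] W[of x\<^sub>0 z\<^sub>0] by (simp add: field_simps)
  then have "c * T x\<^sub>0 z\<^sub>0 \<le> c * T x\<^sub>0 x\<^sub>0"
    using barrier_monotone[OF bar c T[OF adm0] T[OF adm00]] by (simp add: W_def)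
  then have "norm (x\<^sub>0 - z\<^sub>0) \<le> height z\<^sub>0 / 8"
    using near_center[OF c adm1[OF adm0]] adm1[OF adm0]
    by (intro paraboloid_optimal_center[OF c]) (auto simp: T_def)
  \<comment> \<open>1/8 of \<open>height z\<^sub>0\<close> is at most 3/16 of
    \<open>height x\<^sub>0\<close>.\<close>
  then have near0: "norm (x\<^sub>0 - z\<^sub>0) < height x\<^sub>0 / 4"
    using near_center(3)[OF c adm1[OF adm0]] adm1(2)[OF adm0] by linarith

  \<comment> \<open>The touching test function\<close>
  define N where "N = ball 0 r \<inter> (\<lambda>x. height x / 4 - norm (x - z\<^sub>0)) -` {0<..}"
  have "continuous_on (ball 0 r) height"
    by (rule continuous_on_subset[OF continuous_on_height]) (use r in auto)
  then have N_open: "open N"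
    unfolding N_def by (intro continuous_open_preimage continuous_intros) auto
  \<comment> \<open>With the center frozen, the strict inequalities persist near
    \<open>x\<^sub>0\<close>; maximality among admissible pairs then puts one smooth function above
    \<open>v\<close> on all of \<open>N\<close>.\<close>
  have N_adm: "adm x z\<^sub>0" if "x \<in> N" for x
    using that norm_ge_zero[of "x - z\<^sub>0"] unfolding N_def adm_def by (auto simp del: norm_ge_zero)
  have x0N: "x\<^sub>0 \<in> N" using x0r near0 by (simp add: N_def)

  define k where "k = c * 100 * height z\<^sub>0 powr (\<alpha> - 1)"
  define w where "w = (1 / slope z\<^sub>0) *\<^sub>R nrm z\<^sub>0"
  define P where "P t = (s t)\<^sup>2 - s t + t * s' t" for t
  define F where "F t = M * exp (\<Lambda> t)" for t
  define F' where "F' t = M * exp (\<Lambda> t) * (s t / t)" for t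
  define F'' where "F'' t = M * exp (\<Lambda> t) * P t / t\<^sup>2" for t
  define Q where "Q x = height z\<^sub>0 / slope z\<^sub>0 + w \<bullet> (x - z\<^sub>0) + k * (norm (x - z\<^sub>0))\<^sup>2" for x
  have Q: "Q x = T x z\<^sub>0" for x
    by (simp add: Q_def T_def paraboloid_def tangent_def k_def w_def add_divide_distrib)
  have F: "(F has_real_derivative F' t) (at t)" "(F' has_real_derivative F'' t) (at t)" "isCont F'' t"
    if "t \<in> {0<..<t\<^sub>1}" for t
  proof -
    have t: "0 < t" "t < t\<^sub>1" using that by auto
    note b = barrierD[OF bar t]
    show 1: "(F has_real_derivative F' t) (at t)"
      unfolding F_def F'_def using b(1) by (auto intro!: derivative_eq_intros)
    show "(F' has_real_derivative F'' t) (at t)"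
      unfolding F'_def F''_def P_def using b(1,2) t
      by (auto intro!: derivative_eq_intros simp: field_simps power2_eq_square)
    show "isCont F'' t"
      unfolding F''_def P_def using t DERIV_isCont[OF b(1)] DERIV_isCont[OF b(2)] b(3)
      by (intro continuous_intros) auto
  qed
  have "Q x \<in> {0<..<t\<^sub>1}" if "x \<in> N" for x using T[OF N_adm[OF that]] by (simp add: Q)
  note test = quadratic_composition[OF F N_open this[unfolded Q_def], folded Q_def]
  define t where "t = T x\<^sub>0 z\<^sub>0"
  define a where "a = (norm (w + (2 * k) *\<^sub>R (x\<^sub>0 - z\<^sub>0)))\<^sup>2"
  define b where "b = 2 * k * real DIM('a)"
  have lap: "laplacian (\<lambda>x. F (Q x)) x\<^sub>0 = F'' t * a + F' t * b"
    using test(2)[OF _ _ _ _ x0N] by (simp add: Q t_def a_def b_def)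
  have "- laplacian (\<lambda>x. F (Q x)) x\<^sub>0 + \<kappa> / (?d x\<^sub>0)\<^sup>2 * v x\<^sub>0 \<le> 0"
  proof -
    have "Ck_on 2 (\<lambda>x. F (Q x)) N" by (rule test(1)) auto
    moreover have "F (Q x\<^sub>0) = v x\<^sub>0" by (simp add: F_def Q v0 W_def)
    moreover have "v x \<le> F (Q x)" if "x \<in> N" for x
      using max[OF N_adm[OF that]] W[of x z\<^sub>0] by (simp add: F_def Q W_def pos_divide_le_eq)
    moreover have "N \<subseteq> \<Omega> \<inter> ball 0 1" using mem N_adm by blast
    moreover have "x\<^sub>0 \<in> \<Omega> \<inter> ball 0 1" using mem[OF adm0] by simp
    ultimately show ?thesis
      using subsol N_open x0N unfolding viscosity_subsolution_def by blast
  qed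
  moreover have "F'' t * a + F' t * b < \<kappa> / (?d x\<^sub>0)\<^sup>2 * v x\<^sub>0"
  proof -
    note A = c adm1[OF adm0]
    have t: "0 < t" "t < t\<^sub>1" using T[OF adm0] by (auto simp: t_def)
    define \<delta> where "\<delta> = 3200 * real DIM('a) * t powr \<alpha>"
    have "1200 \<le> 3200 * real DIM('a)" using D by linarith
    then have "1200 * t powr \<alpha> \<le> \<delta>" unfolding \<delta>_def by (intro mult_right_mono) simp_all
    moreover have "\<bar>a - 1\<bar> \<le> 1200 * t powr \<alpha>"
      using paraboloid_gradient[OF A] by (simp add: a_def w_def k_def t_def T_def)
    ultimately have "\<bar>a - 1\<bar> \<le> \<delta>" by linarith
    moreover have "\<bar>t * b\<bar> \<le> \<delta>"
      using paraboloid_laplacian[OF A] by (simp add: b_def k_def t_def T_def \<delta>_def)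
    moreover have "\<bar>?d x\<^sub>0 / t - 1\<bar> \<le> \<delta>"
      using reg_dist_paraboloid[OF A \<phi>] by (simp add: t_def T_def \<delta>_def)
    moreover have "\<delta> \<le> 1 / 2" using paraboloid_small[OF A] by (simp add: t_def T_def \<delta>_def)
    moreover have "P t + 10 * \<delta> * (\<bar>P t\<bar> + \<bar>s t\<bar> + \<bar>\<kappa>\<bar>) < \<kappa>"
      using barrierD(5)[OF bar t] by (simp add: P_def \<delta>_def)
    ultimately have *: "P t * a + s t * (t * b) < \<kappa> * t\<^sup>2 / (?d x\<^sub>0)\<^sup>2"
      using t(1) by (intro perturbed_barrier_inequality[of _ \<delta>])
    \<comment> \<open>\<open>F t\<close> equals \<open>v x\<^sub>0\<close> at the touching point, so
      multiplying the perturbed inequality by \<open>F t / t\<^sup>2\<close> gives the reverse of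
      the subsolution inequality.\<close>
    have "F'' t * a + F' t * b = (F t / t\<^sup>2) * (P t * a + s t * (t * b))"
      using t by (simp add: F''_def F'_def F_def field_simps power2_eq_square)
    also have "\<dots> < (F t / t\<^sup>2) * (\<kappa> * t\<^sup>2 / (?d x\<^sub>0)\<^sup>2)"
      using * t M by (intro mult_strict_left_mono) (auto simp: F_def)
    also have "\<dots> = \<kappa> / (?d x\<^sub>0)\<^sup>2 * v x\<^sub>0" using t by (simp add: F_def v0 W_def t_def)
    finally show ?thesis .
  qed
  ultimately show False using lap by simp
qed

end

theorem lemma1p3:
  fixes e :: "'a::euclidean_space" and \<alpha> :: real and \<phi> :: "'a \<Rightarrow> real"
  assumes "e \<in> Basis"
    and "0 < \<alpha>" and "\<alpha> < 1"
    and "radial_mollifier \<phi>"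
  shows "\<exists>\<rho>::real. 0 < \<rho> \<and> \<rho> < 1 \<and>
    (\<forall>(\<kappa>::real) (\<Omega>::'a set) (v::'a \<Rightarrow> real).
       - 1 / 4 \<le> \<kappa> \<and>
       C1_holder_domain e \<alpha> \<Omega> \<and>
       continuous_on (\<Omega> \<inter> ball 0 1) v \<and>
       viscosity_subsolution (\<Omega> \<inter> ball 0 1) (\<lambda>x. \<kappa> / (reg_dist \<phi> \<Omega> x)\<^sup>2) v \<and>
       (- 1 / 4 < \<kappa> \<longrightarrow>
          boundary_limsup_nonpos \<Omega> (\<lambda>x. v x / reg_dist \<phi> \<Omega> x powr theta_minus \<kappa>)) \<and>
       (\<kappa> = - 1 / 4 \<longrightarrow>
          boundary_limsup_nonpos \<Omega>
            (\<lambda>x. v x / (reg_dist \<phi> \<Omega> x powr (1 / 2) * \<bar>ln (reg_dist \<phi> \<Omega> x)\<bar>)))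
       \<longrightarrow> (\<forall>r. 0 < r \<and> r \<le> \<rho> \<longrightarrow>
              (\<forall>x \<in> \<Omega> \<inter> sphere 0 r. v x \<le> 0) \<longrightarrow> (\<forall>x \<in> \<Omega> \<inter> ball 0 r. v x \<le> 0)))"
proof -
  have "0 \<le> 32000 * real DIM('a)" by simp
  from barrier_exists[OF assms(2,3) this]
  obtain t\<^sub>1 where t1: "0 < t\<^sub>1" and bar: "\<forall>\<kappa>\<ge>- 1 / 4. \<exists>c \<Lambda> s s' B c\<^sub>0.
      \<bar>c\<bar> = 1 \<and> barrier \<kappa> \<alpha> (32000 * real DIM('a)) t\<^sub>1 c \<Lambda> s s' \<and> 0 < c\<^sub>0 \<and>
      (\<forall>t d. 0 < t \<and> t < t\<^sub>1 \<and> t / 2 \<le> d \<and> d \<le> 2 * t \<longrightarrow> 0 < B d \<and> c\<^sub>0 * B d \<le> exp (\<Lambda> t)) \<and>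
      (- 1 / 4 < \<kappa> \<and> B = (\<lambda>d. d powr theta_minus \<kappa>) \<or>
       \<kappa> = - 1 / 4 \<and> B = (\<lambda>d. d powr (1 / 2) * \<bar>ln d\<bar>))"
    by (elim exE conjE)
  \<comment> \<open>Solves
    \<open>12800 * real DIM('a) * (2 * \<rho>') powr \<alpha> = 1\<close>.\<close>
  define \<rho>' where "\<rho>' = (1 / (12800 * real DIM('a))) powr (1 / \<alpha>) / 2"
  \<comment> \<open>The fifth of \<open>t\<^sub>1\<close> makes \<open>4 * r < t\<^sub>1\<close>
    strict. As \<open>t\<^sub>1\<close> is obtained before \<kappa>, \<Omega> and \<open>v\<close>,
    so is \<rho>.\<close>
  define \<rho> where "\<rho> = min (1 / 20) (min (t\<^sub>1 / 5) \<rho>')"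
  have \<rho>': "0 < \<rho>'" by (simp add: \<rho>'_def)
  have \<rho>: "0 < \<rho>" "\<rho> \<le> 1 / 20" "\<rho> \<le> t\<^sub>1 / 5" "\<rho> \<le> \<rho>'" using t1 \<rho>' by (auto simp: \<rho>_def)
  have "v x \<le> 0"
    if \<kappa>: "- 1 / 4 \<le> \<kappa>" and dom: "C1_holder_domain e \<alpha> \<Omega>"
      and cont: "continuous_on (\<Omega> \<inter> ball 0 1) v"
      and subsol: "viscosity_subsolution (\<Omega> \<inter> ball 0 1) (\<lambda>x. \<kappa> / (reg_dist \<phi> \<Omega> x)\<^sup>2) v"
      and boundary: "- 1 / 4 < \<kappa> \<longrightarrow>
          boundary_limsup_nonpos \<Omega> (\<lambda>x. v x / reg_dist \<phi> \<Omega> x powr theta_minus \<kappa>)"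
        "\<kappa> = - 1 / 4 \<longrightarrow> boundary_limsup_nonpos \<Omega>
            (\<lambda>x. v x / (reg_dist \<phi> \<Omega> x powr (1 / 2) * \<bar>ln (reg_dist \<phi> \<Omega> x)\<bar>))"
      and r: "0 < r" "r \<le> \<rho>" and sphere: "\<forall>x \<in> \<Omega> \<inter> sphere 0 r. v x \<le> 0"
      and x: "x \<in> \<Omega> \<inter> ball 0 r"
    for \<kappa> :: real and \<Omega> :: "'a set" and v r x
  proof -
    obtain g Dg where "graph_domain e \<alpha> g Dg \<Omega>"
      using C1_holder_domain_imp_graph_domain[OF dom assms(1-3)] .
    then interpret graph_domain e \<alpha> g Dg \<Omega> .
    obtain c \<Lambda> s s' B c\<^sub>0 where b: "\<bar>c\<bar> = 1" "barrier \<kappa> \<alpha> (32000 * real DIM('a)) t\<^sub>1 c \<Lambda> s s'" "0 < c\<^sub>0"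
        "\<forall>t d. 0 < t \<and> t < t\<^sub>1 \<and> t / 2 \<le> d \<and> d \<le> 2 * t \<longrightarrow> 0 < B d \<and> c\<^sub>0 * B d \<le> exp (\<Lambda> t)"
        "- 1 / 4 < \<kappa> \<and> B = (\<lambda>d. d powr theta_minus \<kappa>) \<or>
         \<kappa> = - 1 / 4 \<and> B = (\<lambda>d. d powr (1 / 2) * \<bar>ln d\<bar>)"
      using bar[rule_format, OF \<kappa>] by (elim exE conjE) (rule that; assumption)
    have "(2 * r) powr \<alpha> \<le> ((1 / (12800 * real DIM('a))) powr (1 / \<alpha>)) powr \<alpha>"
      using r \<rho> assms(2) by (intro powr_mono2) (auto simp: \<rho>'_def)
    also have "\<dots> = 1 / (12800 * real DIM('a))" using assms(2) by (simp add: powr_powr)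
    finally have small: "12800 * real DIM('a) * (2 * r) powr \<alpha> \<le> 1" by (simp add: field_simps)
    have "boundary_limsup_nonpos \<Omega> (\<lambda>x. v x / B (reg_dist \<phi> \<Omega> x))"
      using b(5) boundary by auto
    then show ?thesis
      using comparison[OF assms(4) b(2,1) r(1) _ small _ b(3) _ cont subsol _ sphere x] r \<rho> t1 b(4) by auto
  qed
  note main = this
  show ?thesis
  proof (rule exI[of _ \<rho>], intro conjI allI impI ballI, goal_cases)
    case (3 \<kappa> \<Omega> v r x)
    then show ?case by (elim conjE) (rule main)
  qed (use \<rho> in linarith)+
qed

end
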